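(* Let $\Omega\subset\mathbb{R}^2$ be a rectangular domain and let $u$ be the torsion function of $\Omega$. Then the location of the maximal norm of the gradient of $u$ is at the middle points of the longer sides of $\Omega$; that is, the points at which $|\nabla u|$ attains its maximum are the middle points of the longer sides.
   Context: The torsion function of a bounded domain $\Omega$ is the solution $u$ of $-\Delta u=1$ in $\Omega$, $u=0$ on $\partial\Omega$. For a rectangle, $u$ is $C^1$ up to the boundary, and the maximum of $|\nabla u|$ is taken over $\overline\Omega$. "Longer sides" means the sides of maximal length (all four sides if $\Omega$ is a square). *)

theory Defs
  imports "HOL-Analysis.Analysis"
begin

text \<open>The gradient is taken relative to a set \<open>S\<close>, so that it also makes sense at boundary
  points: on an open set it is the usual gradient, and on the closure of an open rectangle it is
  the (unique) one-sided gradient, determined by the values of \<open>u\<close> on the closure only.\<close>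

definition has_gradient_within ::
    "('a::euclidean_space \<Rightarrow> real) \<Rightarrow> 'a \<Rightarrow> 'a \<Rightarrow> 'a set \<Rightarrow> bool" where
  "has_gradient_within u g x S \<longleftrightarrow> (u has_derivative (\<lambda>h. g \<bullet> h)) (at x within S)"

definition gradient_within :: "'a::euclidean_space set \<Rightarrow> ('a \<Rightarrow> real) \<Rightarrow> 'a \<Rightarrow> 'a" where
  "gradient_within S u x = (THE g. has_gradient_within u g x S)"

definition C1_on :: "'a::euclidean_space set \<Rightarrow> ('a \<Rightarrow> real) \<Rightarrow> bool" where
  "C1_on S u \<longleftrightarrow>
     (\<forall>x\<in>S. \<exists>g. has_gradient_within u g x S) \<and> continuous_on S (gradient_within S u)"

definition C2_on :: "'a::euclidean_space set \<Rightarrow> ('a \<Rightarrow> real) \<Rightarrow> bool" where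
  "C2_on S u \<longleftrightarrow> C1_on S u \<and> (\<forall>e\<in>Basis. C1_on S (\<lambda>x. gradient_within S u x \<bullet> e))"

definition laplacian_on :: "'a::euclidean_space set \<Rightarrow> ('a \<Rightarrow> real) \<Rightarrow> 'a \<Rightarrow> real" where
  "laplacian_on S u x =
     (\<Sum>e\<in>Basis. gradient_within S (\<lambda>y. gradient_within S u y \<bullet> e) x \<bullet> e)"

text \<open>Classical solution of \<open>-\<Delta>u = 1\<close> in \<open>\<Omega>\<close>, \<open>u = 0\<close> on the boundary, for an open set \<open>\<Omega>\<close>.
  Differentiability up to the boundary is not part of the definition.\<close>

definition torsion_function :: "'a::euclidean_space set \<Rightarrow> ('a \<Rightarrow> real) \<Rightarrow> bool" where
  "torsion_function \<Omega> u \<longleftrightarrow>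
     C2_on \<Omega> u \<and> continuous_on (closure \<Omega>) u \<and>
     (\<forall>x\<in>\<Omega>. - laplacian_on \<Omega> u x = 1) \<and> (\<forall>x\<in>frontier \<Omega>. u x = 0)"

text \<open>The open parallelogram with vertex \<open>p\<close> and edge vectors \<open>v\<close>, \<open>w\<close>; it is a rectangle, in
  arbitrary position, when \<open>v\<close> and \<open>w\<close> are nonzero and orthogonal.\<close>

definition rectangle :: "real^2 \<Rightarrow> real^2 \<Rightarrow> real^2 \<Rightarrow> (real^2) set" where
  "rectangle p v w = {p + s *\<^sub>R v + t *\<^sub>R w | s t. 0 < s \<and> s < 1 \<and> 0 < t \<and> t < 1}"

text \<open>A side is represented by the pair of its endpoints.\<close>

definition sides :: "real^2 \<Rightarrow> real^2 \<Rightarrow> real^2 \<Rightarrow> ((real^2) \<times> (real^2)) set" where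
  "sides p v w = {(p, p + v), (p + w, p + v + w), (p, p + w), (p + v, p + v + w)}"

definition longer_sides :: "real^2 \<Rightarrow> real^2 \<Rightarrow> real^2 \<Rightarrow> ((real^2) \<times> (real^2)) set" where
  "longer_sides p v w =
     {(a, b) \<in> sides p v w. \<forall>(a', b') \<in> sides p v w. dist a' b' \<le> dist a b}"

end

theory Submission
  imports Defs "HOL-Complex_Analysis.Cauchy_Integral_Formula"
begin

text \<open>In coordinates with \<open>\<Omega> = {\<bar>x\<bar> < a, \<bar>y\<bar> < b}\<close>, the weak maximum principle identifies \<open>u\<close> with
  \<open>(b\<^sup>2 - y\<^sup>2) / 2 - Re \<Phi>(x + i y)\<close>, where \<open>\<Phi>\<close> is the sum of \<open>\<alpha>\<^sub>n cosh (k\<^sub>n z) / cosh (k\<^sub>n a)\<close>, the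
  \<open>k\<^sub>n\<close> are the odd multiples of \<open>\<pi> / (2 b)\<close>, and \<open>(b\<^sup>2 - y\<^sup>2) / 2\<close> is the sum of \<open>\<alpha>\<^sub>n cos (k\<^sub>n y)\<close>. The
  derived series converges uniformly on the closed rectangle, so \<open>u\<close> is \<open>C\<^sup>1\<close> up to the boundary.
  Since \<open>\<bar>\<nabla>u\<bar>\<^sup>2\<close> is strictly subharmonic, it is maximal only at boundary points. On the sides
  \<open>y = \<plusminus>b\<close> it is the square of a sum of positive multiples of \<open>1 - cosh (k\<^sub>n x) / cosh (k\<^sub>n a)\<close>,
  strictly largest at \<open>x = 0\<close>; exchanging the roles of \<open>a\<close> and \<open>b\<close> settles the other two sides.
  If \<open>a \<ge> b\<close>, reflection in the bisector through the corner \<open>(a, b)\<close> and the maximum principle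
  bound the slope at the middle of the short side \<open>x = a\<close> by the slope at \<open>(a - b, b)\<close>, hence
  by the slope at \<open>(0, b)\<close>.\<close>

section \<open>The Fourier series of a parabola\<close>

text \<open>The product \<open>2 cos t sin ((2n+1) t)\<close> splits into
  \<open>sin ((2n+2) t) + sin (2n t)\<close>, so the sum with alternating signs telescopes.\<close>

lemma alternating_odd_sine_sum:
  "2 * cos t * (\<Sum>n<N. (-1)^n * sin ((2 * real n + 1) * t)) = (-1)^(N+1) * sin (2 * real N * t)"
proof (induction N)
  case (Suc N)
  have "2 * cos t * sin ((2 * real N + 1) * t) = sin (2 * real (Suc N) * t) + sin (2 * real N * t)"
    using sin_times_cos[of "(2 * real N + 1) * t" t] by (simp add: algebra_simps)
  then have "2 * cos t * ((-1)^N * sin ((2 * real N + 1) * t))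
      = (-1)^N * (sin (2 * real (Suc N) * t) + sin (2 * real N * t))"
    by (metis mult.left_commute)
  with Suc show ?case
    by (simp add: distrib_left algebra_simps)
qed simp

lemma alternating_odd_cosine_sum_close_to_0:
  fixes c t :: real
  assumes c: "0 < c" "c < pi / 2" and t: "\<bar>t\<bar> \<le> c" and N: "N > 0"
  shows "\<bar>(\<Sum>n<N. (-1)^n * cos ((2 * real n + 1) * t) / (2 * real n + 1))
          - (\<Sum>n<N. (-1)^n / (2 * real n + 1))\<bar> \<le> (2 + c) / (cos c)^2 / real N"
proof -
  define E where "E x = (\<Sum>n<N. (-1)^n * cos ((2 * real n + 1) * x) / (2 * real n + 1))" for x
  text \<open>Here \<open>E' = \<plusminus> sin (2 N x) / (2 cos x)\<close>; adding \<open>R\<close>, itself \<open>O(1/N)\<close>, makes the derivative \<open>O(1/N)\<close>.\<close>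
  define R where "R x = (-1)^N * cos (2 * real N * x) / (4 * real N * cos x)" for x
  have cosc: "0 < cos c" "cos c \<le> 1"
    using c by (auto intro!: cos_gt_zero)
  have cosx: "cos c \<le> cos x" if "\<bar>x\<bar> \<le> c" for x
    using cos_monotone_0_pi_le[of "\<bar>x\<bar>" c] that c by simp
  have E': "(E has_real_derivative - (\<Sum>n<N. (-1)^n * sin ((2 * real n + 1) * x))) (at x)" for x
    unfolding E_def sum_negf[symmetric]
  proof (rule DERIV_sum)
    have "((\<lambda>x. s * cos (k * x) / k) has_real_derivative - (s * sin (k * x))) (at x)" if "k \<noteq> 0" for s k
      using that by (auto intro!: derivative_eq_intros)
    then show "((\<lambda>x. (-1)^n * cos ((2 * real n + 1) * x) / (2 * real n + 1)) has_real_derivative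
        - ((-1)^n * sin ((2 * real n + 1) * x))) (at x)" for n
      by (simp add: add_eq_0_iff)
  qed
  have E'': "- (\<Sum>n<N. (-1)^n * sin ((2 * real n + 1) * x)) = (-1)^N * sin (2 * real N * x) / (2 * cos x)"
    if "cos x > 0" for x
    using alternating_odd_sine_sum[of x N] that by (simp add: field_simps)
  have R': "(R has_real_derivative (- ((-1)^N * sin (2 * real N * x) / (2 * cos x))
      + (-1)^N * cos (2 * real N * x) * sin x / (4 * real N * (cos x)^2))) (at x)" if "cos x > 0" for x
  proof -
    have "((\<lambda>x. s * cos (m * x) / (2 * m * cos x)) has_real_derivative
        - (s * sin (m * x) / (2 * cos x)) + s * cos (m * x) * sin x / (2 * m * (cos x)^2)) (at x)"
      if "m \<noteq> 0" for s m
      using that \<open>cos x > 0\<close>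
      by (auto intro!: derivative_eq_intros simp: divide_simps power2_eq_square) (simp add: algebra_simps)
    from this[of "2 * real N" "(-1)^N"] show ?thesis
      using N by (simp add: R_def[abs_def])
  qed
  \<comment> \<open>On [-c, c] the number \<open>B\<close> bounds both the derivative of
    \<open>E + R\<close> and \<open>R\<close> itself, so \<open>E\<close> moves by at most
    \<open>B c + 2 B\<close>.\<close>
  define B where "B = 1 / (4 * real N * (cos c)^2)"
  have "norm ((E t + R t) - (E 0 + R 0)) \<le> B * norm (t - 0)"
  proof (rule field_differentiable_bound[where S = "{-c..c}"])
    fix x assume "x \<in> {-c..c}"
    then have x: "\<bar>x\<bar> \<le> c" by auto
    then have cx: "cos x > 0" using cosx cosc by force
    show "((\<lambda>x. E x + R x) has_real_derivative
        (-1)^N * cos (2 * real N * x) * sin x / (4 * real N * (cos x)^2)) (at x within {-c..c})"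
      by (rule has_field_derivative_at_within[OF DERIV_cong[OF DERIV_add[OF E' R'[OF cx]]]])
        (simp add: E''[OF cx])
    have "\<bar>cos (2 * real N * x) * sin x\<bar> \<le> 1"
      using mult_mono[of "\<bar>cos (2 * real N * x)\<bar>" 1 "\<bar>sin x\<bar>" 1] by (simp add: abs_mult)
    moreover have "(cos c)^2 \<le> (cos x)^2"
      using cosx[OF x] cosc by (simp add: power_mono)
    ultimately have "\<bar>cos (2 * real N * x) * sin x\<bar> / (4 * real N * (cos x)^2) \<le> B"
      unfolding B_def using cosc N cx by (intro frac_le) auto
    then show "norm ((-1)^N * cos (2 * real N * x) * sin x / (4 * real N * (cos x)^2)) \<le> B"
      by (simp add: abs_mult power_abs)
  qed (use t c in auto)
  then have 1: "\<bar>(E t + R t) - (E 0 + R 0)\<bar> \<le> B * c"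
    using t cosc unfolding B_def
    by (smt (verit) mult_left_mono of_nat_0_le_iff real_norm_def zero_le_divide_iff zero_le_mult_iff zero_le_power2)
  have R: "\<bar>R x\<bar> \<le> B" if "\<bar>x\<bar> \<le> c" for x
  proof -
    have "(cos c)^2 \<le> cos x"
      using cosx[OF that] cosc by (smt (verit) mult_left_le_one_le power2_eq_square)
    then have "\<bar>cos (2 * real N * x)\<bar> / (4 * real N * cos x) \<le> B"
      unfolding B_def using cosc N by (intro frac_le) auto
    moreover have "cos x > 0" using cosx[OF that] cosc by simp
    ultimately show ?thesis
      by (simp add: R_def abs_mult power_abs)
  qed
  have "\<bar>E t - E 0\<bar> \<le> B * (2 + c)"
    using 1 R[OF t] R[of 0] c by (simp add: algebra_simps)
  also have "B * (2 + c) \<le> (2 + c) / (cos c)^2 / real N"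
    unfolding B_def using cosc N c by (simp add: field_simps)
  finally show ?thesis by (simp add: E_def)
qed

text \<open>At \<open>t = 0\<close> this is the Leibniz series for arctan 1; the uniform rate
  carries its limit to all other \<open>t\<close>.\<close>

lemma uniform_limit_alternating_odd_cosine_sum:
  fixes c :: real
  assumes c: "0 < c" "c < pi / 2"
  shows "uniform_limit {-c..c} (\<lambda>N t. \<Sum>n<N. (-1)^n * cos ((2 * real n + 1) * t) / (2 * real n + 1))
           (\<lambda>_. pi / 4) sequentially"
proof -
  have "(\<lambda>n. (-1)^n * (1 / real (n * 2 + 1)) * 1 ^ (n * 2 + 1)) sums arctan 1"
    using arctan_series[of 1] summable_arctan_series[of 1] by (simp add: sums_iff)
  then have "(\<lambda>n. (-1)^n / (2 * real n + 1)) sums (pi / 4)"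
    by (simp add: arctan_one mult.commute add.commute)
  then have L: "(\<lambda>N. \<Sum>n<N. (-1)^n / (2 * real n + 1)) \<longlonglongrightarrow> pi / 4"
    by (simp add: sums_def)
  have K: "(\<lambda>N. (2 + c) / (cos c)^2 / real N) \<longlonglongrightarrow> 0"
    by (rule lim_const_over_n)
  show ?thesis
  proof (rule uniform_limitI)
    fix e :: real assume "e > 0"
    have "\<forall>\<^sub>F N in sequentially. dist (\<Sum>n<N. (-1)^n / (2 * real n + 1)) (pi / 4) < e / 2"
      by (rule tendstoD[OF L]) (use \<open>e > 0\<close> in simp)
    moreover have "\<forall>\<^sub>F N in sequentially. dist ((2 + c) / (cos c)^2 / real N) 0 < e / 2"
      by (rule tendstoD[OF K]) (use \<open>e > 0\<close> in simp)
    ultimately show "\<forall>\<^sub>F N in sequentially. \<forall>t\<in>{-c..c}.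
        dist (\<Sum>n<N. (-1)^n * cos ((2 * real n + 1) * t) / (2 * real n + 1)) (pi / 4) < e"
      using eventually_gt_at_top[of 0]
    proof eventually_elim
      case (elim N)
      show ?case
      proof
        fix t assume "t \<in> {-c..c}"
        then have "\<bar>t\<bar> \<le> c" by auto
        from alternating_odd_cosine_sum_close_to_0[OF c this elim(3)] elim(1,2)
        show "dist (\<Sum>n<N. (-1)^n * cos ((2 * real n + 1) * t) / (2 * real n + 1)) (pi / 4) < e"
          unfolding dist_real_def by linarith
      qed
    qed
  qed
qed

lemma summable_inverse_odd_square: "summable (\<lambda>n. 1 / (2 * real n + 1)^2)"
  and summable_inverse_odd_cube: "summable (\<lambda>n. 1 / (2 * real n + 1)^3)"
proof -
  have s: "summable (\<lambda>n. 1 / (real n + 1)^2)"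
    using inverse_squares_sums by (simp add: sums_iff add.commute)
  show 1: "summable (\<lambda>n. 1 / (2 * real n + 1)^2)"
    by (rule summable_comparison_test[OF _ s]) (auto intro!: exI[of _ 0] divide_left_mono power_mono)
  show "summable (\<lambda>n. 1 / (2 * real n + 1)^3)"
    by (rule summable_comparison_test[OF _ 1]) (auto intro!: exI[of _ 0] divide_left_mono power_increasing)
qed

lemma cos_odd_half_pi: "cos ((2 * real n + 1) * (pi / 2)) = 0"
  unfolding distrib_right cos_add by simp

lemma sin_odd_half_pi: "sin ((2 * real n + 1) * (pi / 2)) = (-1)^n"
proof -
  have "sin ((2 * real n + 1) * (pi / 2)) = cos (real n * pi)"
    unfolding distrib_right sin_add by simp
  then show ?thesis by simp
qed

text \<open>Two termwise differentiations lead to the negative of the series just summed, the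
  constant -pi/4 on the open interval. Integrating back twice gives the parabola, and the first
  derivative at pi/2 gives the sum of the inverse odd squares.\<close>

lemma alternating_odd_cosine_cube_series:
  shows "\<bar>t\<bar> \<le> pi / 2 \<Longrightarrow>
      (\<lambda>n. (-1)^n * cos ((2 * real n + 1) * t) / (2 * real n + 1)^3) sums (pi / 8 * ((pi/2)^2 - t^2))"
    and "(\<lambda>n. 1 / (2 * real n + 1)^2) sums (pi^2 / 8)"
proof -
  define f where "f n t = (-1)^n * cos ((2 * real n + 1) * t) / (2 * real n + 1)^3" for n t
  define f1 where "f1 n t = - ((-1)^n * sin ((2 * real n + 1) * t) / (2 * real n + 1)^2)" for n t
  define f2 where "f2 n t = - ((-1)^n * cos ((2 * real n + 1) * t) / (2 * real n + 1))" for n t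
  define g where "g t = (\<Sum>n. f n t)" for t
  define g1 where "g1 t = (\<Sum>n. f1 n t)" for t
  have nz: "2 * real n + 1 \<noteq> 0" for n by (simp add: add_eq_0_iff)
  have D: "((\<lambda>t. s * cos (k * t) / k^3) has_real_derivative - (s * sin (k * t) / k^2)) (at t within S)"
    and D1: "((\<lambda>t. - (s * sin (k * t) / k^2)) has_real_derivative - (s * cos (k * t) / k)) (at t within S)"
    if "k \<noteq> 0" for s k t S
    using that by (auto intro!: derivative_eq_intros simp: divide_simps power2_eq_square power3_eq_cube)
  have df: "(f n has_real_derivative f1 n t) (at t within S)" for n t S
    unfolding f_def f1_def by (rule D[OF nz])
  have df1: "(f1 n has_real_derivative f2 n t) (at t within S)" for n t S
    unfolding f1_def f2_def by (rule D1[OF nz])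
  have bf: "norm (f n t) \<le> 1 / (2 * real n + 1)^3" for n t
    unfolding f_def by (simp add: abs_mult power_abs divide_right_mono)
  have bf1: "norm (f1 n t) \<le> 1 / (2 * real n + 1)^2" for n t
    unfolding f1_def by (simp add: abs_mult power_abs divide_right_mono)
  have sf: "summable (\<lambda>n. f n t)" for t
    by (rule summable_comparison_test'[OF summable_inverse_odd_cube, of 0]) (use bf in auto)
  have sf1: "summable (\<lambda>n. f1 n t)" for t
    by (rule summable_comparison_test'[OF summable_inverse_odd_square, of 0]) (use bf1 in auto)
  have ul: "uniform_limit UNIV (\<lambda>n t. \<Sum>i<n. f1 i t) g1 sequentially"
    unfolding g1_def by (rule Weierstrass_m_test[OF bf1 summable_inverse_odd_square])
  have dg: "(g has_real_derivative g1 t) (at t)" for t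
  proof -
    obtain h where h: "\<And>x. (\<lambda>n. f n x) sums h x" "\<And>x. (h has_real_derivative g1 x) (at x)"
      using has_field_derivative_series[OF convex_UNIV df ul UNIV_I sf[of 0]] by auto
    have "h = g" using h(1) by (auto simp: g_def sums_iff)
    with h(2) show ?thesis by simp
  qed
  have cg1: "continuous_on UNIV g1"
    using ul by (rule uniform_limit_theorem[rotated])
      (auto simp: f1_def nz intro!: continuous_intros always_eventually)
  \<comment> \<open>The series of \<open>f2\<close> converges uniformly on compact subintervals,
    hence the intermediate \<open>c\<close> between |t| and pi/2.\<close>
  have dg1: "(g1 has_real_derivative - pi / 4) (at t)" if t: "\<bar>t\<bar> < pi / 2" for t
  proof -
    obtain c where c: "\<bar>t\<bar> < c" "c < pi / 2" using dense t by blast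
    then have c0: "0 < c" by linarith
    have "uniform_limit {-c..c} (\<lambda>n t. \<Sum>i<n. f2 i t) (\<lambda>_. - pi / 4) sequentially"
      using uniform_limit_uminus[OF uniform_limit_alternating_odd_cosine_sum[OF c0 c(2)]]
      unfolding f2_def sum_negf by simp
    then obtain h where h: "\<And>x. x \<in> {-c..c} \<Longrightarrow> (\<lambda>n. f1 n x) sums h x"
      "\<And>x. x \<in> {-c..c} \<Longrightarrow> (h has_real_derivative - pi / 4) (at x within {-c..c})"
      using has_field_derivative_series[OF _ df1 _ _ sf1[of 0], of "{-c..c}" "\<lambda>_. - pi / 4"] c0
      by (metis atLeastAtMost_iff convex_real_interval(5) less_eq_real_def neg_le_0_iff_le)
    have "t \<in> interior {-c..c}" using c by auto
    then have "(h has_real_derivative - pi / 4) (at t)"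
      using h(2)[of t] at_within_interior[of t "{-c..c}"] by auto
    then show ?thesis
      by (rule has_field_derivative_transform_within_open[where S = "{-c<..<c}"])
        (use c h(1) in \<open>force simp: g1_def sums_iff\<close>)+
  qed
  have g10: "g1 0 = 0" by (simp add: g1_def f1_def)
  \<comment> \<open>The derivative is known in the open interval only; continuity of
    \<open>g1\<close> extends the formula to the two endpoints collected in \<open>K\<close>, and
    the value at pi/2 is needed next.\<close>
  have g1_eq: "g1 t = - pi / 4 * t" if t: "\<bar>t\<bar> \<le> pi / 2" for t
  proof -
    have "g1 t + pi / 4 * t = g1 0 + pi / 4 * 0"
    proof (rule has_derivative_zero_unique_strong_convex[where S = "{-pi/2..pi/2}" and K = "{-pi/2, pi/2}"
          and f = "\<lambda>t. g1 t + pi / 4 * t" and c = 0])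
      show "continuous_on {-pi/2..pi/2} (\<lambda>t. g1 t + pi / 4 * t)"
        by (intro continuous_intros continuous_on_subset[OF cg1]) auto
      fix x assume "x \<in> {-pi/2..pi/2} - {-pi/2, pi/2}"
      then have "\<bar>x\<bar> < pi / 2" by auto
      from dg1[OF this] have "((\<lambda>t. g1 t + pi / 4 * t) has_real_derivative 0) (at x)"
        by (auto intro!: derivative_eq_intros)
      then show "((\<lambda>t. g1 t + pi / 4 * t) has_derivative (\<lambda>h. 0)) (at x within {-pi/2..pi/2})"
        unfolding has_field_derivative_def lambda_zero by (rule has_derivative_at_withinI)
    qed (use t in auto)
    then show ?thesis by (simp add: g10)
  qed
  \<comment> \<open>At pi/2 the sines equal \<open>(-1)^n\<close> and cancel the alternating
    signs.\<close>
  have "g1 (pi/2) = - (\<Sum>n. 1 / (2 * real n + 1)^2)"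
    unfolding g1_def f1_def sin_odd_half_pi power_add[symmetric] mult_2[symmetric]
    using suminf_minus[OF summable_inverse_odd_square] by simp
  then show "(\<lambda>n. 1 / (2 * real n + 1)^2) sums (pi^2 / 8)"
    using g1_eq[of "pi/2"] summable_inverse_odd_square by (simp add: sums_iff power2_eq_square)
  show "(\<lambda>n. (-1)^n * cos ((2 * real n + 1) * t) / (2 * real n + 1)^3) sums (pi / 8 * ((pi/2)^2 - t^2))"
    if t: "\<bar>t\<bar> \<le> pi / 2"
  proof -
    have "g t + pi / 8 * t^2 = g (pi/2) + pi / 8 * (pi/2)^2"
    proof (rule has_derivative_zero_unique_strong_convex[where S = "{-pi/2..pi/2}" and K = "{}"
          and f = "\<lambda>t. g t + pi / 8 * t^2" and c = "pi/2"])
      show "continuous_on {-pi/2..pi/2} (\<lambda>t. g t + pi / 8 * t^2)"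
        using dg by (intro continuous_intros DERIV_continuous_on) (auto intro: has_field_derivative_at_within)
      fix x assume "x \<in> {-pi/2..pi/2} - {}"
      then have "g1 x = - pi / 4 * x" by (intro g1_eq) auto
      then have "((\<lambda>t. g t + pi / 8 * t^2) has_real_derivative 0) (at x)"
        using dg[of x] by (auto intro!: derivative_eq_intros)
      then show "((\<lambda>t. g t + pi / 8 * t^2) has_derivative (\<lambda>h. 0)) (at x within {-pi/2..pi/2})"
        unfolding has_field_derivative_def lambda_zero by (rule has_derivative_at_withinI)
    qed (use t in auto)
    \<comment> \<open>Every cosine vanishes at pi/2, which fixes the constant of
      integration.\<close>
    moreover have "g (pi/2) = 0"
      unfolding g_def f_def cos_odd_half_pi by simp
    ultimately have "g t = pi / 8 * ((pi/2)^2 - t^2)" by (simp add: algebra_simps)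
    then show ?thesis using sf[of t] unfolding f_def g_def by (simp add: sums_iff)
  qed
qed

section \<open>The weak maximum principle\<close>

text \<open>If \<open>d\<close> were positive, \<open>g\<close> would be positive just to the right
  of its zero at 0, and the mean value theorem would lift \<open>f\<close> above
  \<open>f 0\<close>.\<close>

lemma second_derivative_nonpos_at_max:
  fixes f g :: "real \<Rightarrow> real"
  assumes "\<delta> > 0"
    and f: "\<And>t. \<bar>t\<bar> < \<delta> \<Longrightarrow> (f has_real_derivative g t) (at t)"
    and g: "(g has_real_derivative d) (at 0)"
    and max: "\<And>t. \<bar>t\<bar> < \<delta> \<Longrightarrow> f t \<le> f 0"
  shows "d \<le> 0"
proof (rule ccontr)
  assume "\<not> d \<le> 0"
  then have "d > 0" by simp
  have g0: "g 0 = 0"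
    using DERIV_local_max[OF f[of 0] \<open>\<delta> > 0\<close>] max \<open>\<delta> > 0\<close> by simp
  obtain \<eta> where \<eta>: "\<eta> > 0" "\<And>t. 0 < t \<Longrightarrow> t < \<eta> \<Longrightarrow> g 0 < g t"
    using DERIV_pos_inc_right[OF g \<open>d > 0\<close>] by auto
  define t where "t = min \<eta> \<delta> / 2"
  have t: "0 < t" "t < \<eta>" "t < \<delta>"
    using \<eta>(1) \<open>\<delta> > 0\<close> by (auto simp: t_def min_def)
  obtain z where z: "0 < z" "z < t" "f t - f 0 = (t - 0) * g z"
    using MVT2[OF t(1), of f g] f t by auto
  then have "g z > 0"
    using \<eta>(2)[of z] g0 t by simp
  then have "f t > f 0"
    using z t by (metis diff_gt_0_iff_gt diff_zero zero_less_mult_iff)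
  with max[of t] t show False by simp
qed

lemma has_derivative_along_line:
  assumes "(f has_derivative f') (at (q + t *\<^sub>R e))"
  shows "((\<lambda>s. f (q + s *\<^sub>R e)) has_vector_derivative f' e) (at t)"
proof -
  have "((\<lambda>s. q + s *\<^sub>R e) has_derivative (\<lambda>s. s *\<^sub>R e)) (at t)"
    by (auto intro!: derivative_eq_intros)
  from has_derivative_compose[OF this assms] show ?thesis
    using has_derivative_linear[OF assms] by (simp add: has_vector_derivative_def linear_cmul)
qed

text \<open>\<open>G\<close> is a gradient field, \<open>A\<close> its derivative and
  \<open>L\<close> the trace of \<open>A\<close>. Existential witnesses avoid the definite
  description in \<open>gradient_within\<close> and make differences easy to handle.\<close>

definition has_laplacian_on :: "('a::euclidean_space \<Rightarrow> real) \<Rightarrow> ('a \<Rightarrow> real) \<Rightarrow> 'a set \<Rightarrow> bool" where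
  "has_laplacian_on f L S \<longleftrightarrow> (\<exists>G A. \<forall>q\<in>S.
     (f has_derivative (\<lambda>h. G q \<bullet> h)) (at q) \<and> (G has_derivative A q) (at q) \<and>
     L q = (\<Sum>e\<in>Basis. A q e \<bullet> e))"

lemma has_laplacian_on_diff:
  assumes "has_laplacian_on f L S" "has_laplacian_on g M S"
  shows "has_laplacian_on (\<lambda>q. f q - g q) (\<lambda>q. L q - M q) S"
proof -
  obtain G A where 1: "\<And>q. q \<in> S \<Longrightarrow> (f has_derivative (\<lambda>h. G q \<bullet> h)) (at q)"
      "\<And>q. q \<in> S \<Longrightarrow> (G has_derivative A q) (at q)" "\<And>q. q \<in> S \<Longrightarrow> L q = (\<Sum>e\<in>Basis. A q e \<bullet> e)"
    using assms(1) unfolding has_laplacian_on_def by blast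
  obtain H B where 2: "\<And>q. q \<in> S \<Longrightarrow> (g has_derivative (\<lambda>h. H q \<bullet> h)) (at q)"
      "\<And>q. q \<in> S \<Longrightarrow> (H has_derivative B q) (at q)" "\<And>q. q \<in> S \<Longrightarrow> M q = (\<Sum>e\<in>Basis. B q e \<bullet> e)"
    using assms(2) unfolding has_laplacian_on_def by blast
  have "((\<lambda>q. f q - g q) has_derivative (\<lambda>h. (G q - H q) \<bullet> h)) (at q)" if "q \<in> S" for q
    unfolding inner_diff_left by (intro has_derivative_diff 1 2 that)
  moreover have "((\<lambda>q. G q - H q) has_derivative (\<lambda>h. A q h - B q h)) (at q)" if "q \<in> S" for q
    by (intro has_derivative_diff 1 2 that)
  moreover have "L q - M q = (\<Sum>e\<in>Basis. (A q e - B q e) \<bullet> e)" if "q \<in> S" for q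
    by (simp add: inner_diff_left sum_subtractf 1(3) 2(3) that)
  ultimately show ?thesis
    unfolding has_laplacian_on_def
    by (intro exI[of _ "\<lambda>q. G q - H q"] exI[of _ "\<lambda>q h. A q h - B q h"]) blast
qed

text \<open>Adding a small multiple of |x|^2 makes the Laplacian strictly positive, which the second
  derivative test forbids at an interior maximum.\<close>

lemma weak_maximum_principle:
  fixes f :: "'a::euclidean_space \<Rightarrow> real"
  assumes "open S" "bounded S" and cont: "continuous_on (closure S) f"
    and lap: "has_laplacian_on f L S" and L: "\<And>q. q \<in> S \<Longrightarrow> 0 \<le> L q"
    and frontier: "\<And>q. q \<in> frontier S \<Longrightarrow> f q \<le> 0"
    and q: "q \<in> closure S"
  shows "f q \<le> 0"
proof (rule ccontr)
  assume "\<not> f q \<le> 0"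
  then have fq: "f q > 0" by simp
  obtain G A where G: "\<And>q. q \<in> S \<Longrightarrow> (f has_derivative (\<lambda>h. G q \<bullet> h)) (at q)"
      and A: "\<And>q. q \<in> S \<Longrightarrow> (G has_derivative A q) (at q)"
      and LA: "\<And>q. q \<in> S \<Longrightarrow> L q = (\<Sum>e\<in>Basis. A q e \<bullet> e)"
    using lap unfolding has_laplacian_on_def by blast
  have comp: "compact (closure S)" using \<open>bounded S\<close> by simp
  obtain R where R: "\<And>x. x \<in> closure S \<Longrightarrow> norm x \<le> R" "R > 0"
    using \<open>bounded S\<close> bounded_closure bounded_pos by metis
  \<comment> \<open>With this choice the perturbation is at most \<open>f q / 2\<close> on the
    closure, so the values of \<open>h\<close> on the frontier stay below
    \<open>h q\<close>.\<close>
  define \<epsilon> where "\<epsilon> = f q / (2 * R^2)"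
  have \<epsilon>: "\<epsilon> > 0" using fq R by (simp add: \<epsilon>_def)
  define h where "h x = f x + \<epsilon> * (x \<bullet> x)" for x
  have "continuous_on (closure S) h"
    unfolding h_def by (intro continuous_intros cont)
  then obtain m where m: "m \<in> closure S" "\<And>x. x \<in> closure S \<Longrightarrow> h x \<le> h m"
    using continuous_attains_sup[OF comp] q by (metis empty_iff)
  have "m \<notin> frontier S"
  proof
    assume "m \<in> frontier S"
    then have "h m \<le> \<epsilon> * (norm m)^2"
      using frontier by (simp add: h_def power2_norm_eq_inner)
    also have "\<dots> \<le> \<epsilon> * R^2"
      using R(1)[OF m(1)] \<epsilon> by (simp add: power_mono)
    also have "\<dots> < f q" using fq R by (simp add: \<epsilon>_def)
    also have "f q \<le> h q" using \<epsilon> by (simp add: h_def)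
    finally show False using m(2)[OF q] by simp
  qed
  then have mS: "m \<in> S"
    using m(1) \<open>open S\<close> by (simp add: frontier_def interior_open)
  then obtain \<delta> where \<delta>: "\<delta> > 0" "ball m \<delta> \<subseteq> S"
    using \<open>open S\<close> openE by blast
  \<comment> \<open>The left side is the second derivative of \<open>h\<close> at \<open>m\<close>
    in direction \<open>e\<close>; summing over the basis contradicts
    \<open>0 \<le> L m\<close>.\<close>
  have "A m e \<bullet> e + 2 * \<epsilon> \<le> 0" if e: "e \<in> Basis" for e
  proof (rule second_derivative_nonpos_at_max[OF \<delta>(1)])
    fix t :: real assume t: "\<bar>t\<bar> < \<delta>"
    then have tS: "m + t *\<^sub>R e \<in> S"
      using \<delta>(2) e by (auto simp: dist_norm subset_iff)
    have "((\<lambda>s. f (m + s *\<^sub>R e)) has_real_derivative G (m + t *\<^sub>R e) \<bullet> e) (at t)"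
      using has_derivative_along_line[OF G[OF tS]]
      by (simp add: has_real_derivative_iff_has_vector_derivative)
    then show "((\<lambda>s. h (m + s *\<^sub>R e)) has_real_derivative
        G (m + t *\<^sub>R e) \<bullet> e + 2 * \<epsilon> * (m \<bullet> e + t)) (at t)"
      unfolding h_def using e
      by (auto intro!: derivative_eq_intros simp: inner_add_left inner_add_right inner_commute algebra_simps)
    show "h (m + t *\<^sub>R e) \<le> h (m + 0 *\<^sub>R e)"
      using m(2)[of "m + t *\<^sub>R e"] tS closure_subset by auto
  next
    have "((\<lambda>s. G (m + s *\<^sub>R e)) has_vector_derivative A m e) (at 0)"
      using has_derivative_along_line[of G "A m" m 0 e] A[OF mS] by simp
    then have "((\<lambda>s. G (m + s *\<^sub>R e) \<bullet> e) has_real_derivative A m e \<bullet> e) (at 0)"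
      unfolding has_real_derivative_iff_has_vector_derivative
      by (rule bounded_linear.has_vector_derivative[OF bounded_linear_inner_left])
    then show "((\<lambda>s. G (m + s *\<^sub>R e) \<bullet> e + 2 * \<epsilon> * (m \<bullet> e + s)) has_real_derivative
        A m e \<bullet> e + 2 * \<epsilon>) (at 0)"
      by (auto intro!: derivative_eq_intros)
  qed
  then have "(\<Sum>e\<in>Basis. A m e \<bullet> e + 2 * \<epsilon>) \<le> 0"
    by (simp add: sum_nonpos)
  then have "L m + 2 * \<epsilon> * DIM('a) \<le> 0"
    by (simp add: sum.distrib LA[OF mS] mult.commute)
  moreover have "2 * \<epsilon> * DIM('a) > 0" using \<epsilon> by simp
  ultimately show False using L[OF mS] by linarith
qed

lemma dirichlet_problem_unique:
  fixes f g :: "'a::euclidean_space \<Rightarrow> real"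
  assumes "open S" "bounded S" "continuous_on (closure S) f" "continuous_on (closure S) g"
    and "has_laplacian_on f L S" "has_laplacian_on g L S"
    and "\<And>q. q \<in> frontier S \<Longrightarrow> f q = g q" and "q \<in> closure S"
  shows "f q = g q"
proof (rule antisym)
  have "f q - g q \<le> 0"
    by (rule weak_maximum_principle[OF assms(1,2) _ has_laplacian_on_diff[OF assms(5,6)]])
      (use assms in \<open>auto intro!: continuous_intros\<close>)
  then show "f q \<le> g q" by simp
  have "g q - f q \<le> 0"
    by (rule weak_maximum_principle[OF assms(1,2) _ has_laplacian_on_diff[OF assms(6,5)]])
      (use assms in \<open>auto intro!: continuous_intros\<close>)
  then show "g q \<le> f q" by simp
qed

text \<open>Segments from \<open>x\<close> to points of \<open>S\<close> stay in \<open>S\<close>,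
  so both gradients have the same one-sided derivatives along them; an interior ball supplies enough
  directions. This makes gradients at boundary points well defined.\<close>

lemma has_derivative_inner_unique_convex:
  fixes S :: "'a::euclidean_space set"
  assumes "convex S" "interior S \<noteq> {}" "x \<in> S"
    and 1: "(u has_derivative (\<lambda>h. g \<bullet> h)) (at x within S)"
    and 2: "(u has_derivative (\<lambda>h. g' \<bullet> h)) (at x within S)"
  shows "g = g'"
proof -
  have eq: "g \<bullet> (y - x) = g' \<bullet> (y - x)" if y: "y \<in> S" for y
  proof -
    have l: "((\<lambda>s. x + s *\<^sub>R (y - x)) has_derivative (\<lambda>s. s *\<^sub>R (y - x))) (at 0 within {0..1})"
      by (auto intro!: derivative_eq_intros)
    have im: "(\<lambda>s. x + s *\<^sub>R (y - x)) ` {0..1} \<subseteq> S"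
    proof clarify
      fix s :: real assume "s \<in> {0..1}"
      then have "(1 - s) *\<^sub>R x + s *\<^sub>R y \<in> S"
        using convexD_alt[OF \<open>convex S\<close> \<open>x \<in> S\<close> y] by simp
      then show "x + s *\<^sub>R (y - x) \<in> S" by (simp add: algebra_simps)
    qed
    have d: "((\<lambda>s. u (x + s *\<^sub>R (y - x))) has_vector_derivative k \<bullet> (y - x)) (at 0 within {0..1})"
      if "(u has_derivative (\<lambda>h. k \<bullet> h)) (at x within S)" for k
    proof -
      have "(u has_derivative (\<lambda>h. k \<bullet> h)) (at (x + 0 *\<^sub>R (y - x)) within (\<lambda>s. x + s *\<^sub>R (y - x)) ` {0..1})"
        using has_derivative_subset[OF that im] by simp
      from diff_chain_within[OF l this] show ?thesis
        by (simp add: has_vector_derivative_def o_def)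
    qed
    have "at (0::real) within {0..1} \<noteq> bot"
      using trivial_limit_within[of "0::real" "{0..1}"] islimpt_Icc[of 0 1 0] by auto
    from vector_derivative_unique_within[OF this d[OF 1] d[OF 2]] show ?thesis .
  qed
  obtain z \<delta> where z: "\<delta> > 0" "ball z \<delta> \<subseteq> S"
    using assms(2) mem_interior by blast
  have n: "norm (g - g') + 1 > 0" by (simp add: add_nonneg_pos)
  \<comment> \<open>Small enough to keep \<open>z + t *\<^sub>R (g - g')\<close> in the ball; the
    summand 1 avoids division by zero. Subtracting \<open>eq\<close> at the two points leaves
    \<open>t\<close> times the squared norm of \<open>g - g'\<close>.\<close>
  define t where "t = \<delta> / 2 / (norm (g - g') + 1)"
  have t: "t > 0" using z(1) n by (simp add: t_def)
  have "norm (t *\<^sub>R (g - g')) < \<delta>"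
  proof -
    have "t * norm (g - g') \<le> t * (norm (g - g') + 1)" using t by simp
    also have "\<dots> = \<delta> / 2" using n by (simp add: t_def del: distrib_left_numeral)
    finally show ?thesis using t z(1) by simp
  qed
  then have "z + t *\<^sub>R (g - g') \<in> S" "z \<in> S"
    using z by (auto simp: subset_iff dist_norm)
  from eq[OF this(1)] eq[OF this(2)] have "(g - g') \<bullet> (t *\<^sub>R (g - g')) = 0"
    by (simp add: algebra_simps inner_diff_left inner_diff_right inner_add_right)
  then show ?thesis using t by simp
qed

section \<open>The series solution on a rectangle\<close>

lemma Re_cosh: "Re (cosh z) = cosh (Re z) * cos (Im z)"
  and Re_sinh: "Re (sinh z) = sinh (Re z) * cos (Im z)"
  and Im_sinh: "Im (sinh z) = cosh (Re z) * sin (Im z)"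
  by (simp_all add: cosh_field_def sinh_field_def Re_exp Im_exp algebra_simps add_divide_distrib diff_divide_distrib)

lemma norm_cosh_le: "norm (cosh z) \<le> cosh (Re z)"
  and norm_sinh_le: "norm (sinh z) \<le> cosh (Re z)" for z :: complex
proof -
  show "norm (cosh z) \<le> cosh (Re z)"
    using norm_triangle_ineq[of "exp z" "exp (- z)"]
    by (simp add: cosh_field_def norm_divide)
  show "norm (sinh z) \<le> cosh (Re z)"
    using norm_triangle_ineq4[of "exp z" "exp (- z)"]
    by (simp add: cosh_field_def sinh_field_def norm_divide)
qed

lemma cosh_le_cosh_real: "cosh x \<le> cosh y" if "\<bar>x\<bar> \<le> \<bar>y\<bar>" for x y :: real
  using that cosh_real_nonneg_le_iff[of "\<bar>x\<bar>" "\<bar>y\<bar>"] by simp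

section \<open>Odd frequencies and the cosine expansion of the parabola on [-b, b]\<close>

definition freq :: "real \<Rightarrow> nat \<Rightarrow> real" where
  "freq b n = (2 * real n + 1) * (pi / 2) / b"

text \<open>These are the coefficients of \<open>(b^2 - y^2) / 2\<close> with respect to the
  functions \<open>cos (freq b n * y)\<close>, which vanish at both ends of [-b, b].\<close>

definition coef :: "real \<Rightarrow> nat \<Rightarrow> real" where
  "coef b n = 2 * (-1)^n / (b * freq b n ^ 3)"

lemma freq_pos: "b > 0 \<Longrightarrow> freq b n > 0"
  by (simp add: freq_def add_nonneg_pos)

lemma cos_freq: "b > 0 \<Longrightarrow> \<bar>y\<bar> = b \<Longrightarrow> cos (freq b n * y) = 0"
  using cos_odd_half_pi[of n] by (auto simp: freq_def abs_if split: if_splits)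

lemma sin_freq: "b > 0 \<Longrightarrow> \<bar>y\<bar> = b \<Longrightarrow> sin (freq b n * y) = (-1)^n * sgn y"
  using sin_odd_half_pi[of n] by (auto simp: freq_def abs_if split: if_splits)

text \<open>The terms are the majorants of the derived series, and the total \<open>b\<close> is, up
  to sign, the slope of the parabola at the end of the interval.\<close>

lemma freq_square_sums:
  assumes "b > 0"
  shows "(\<lambda>n. 2 / (b * freq b n ^ 2)) sums b"
proof -
  have "2 / (b * freq b n ^ 2) = 8 * b / pi^2 * (1 / (2 * real n + 1)^2)" for n
    using assms by (simp add: freq_def power2_eq_square)
  moreover have "(\<lambda>n. 8 * b / pi^2 * (1 / (2 * real n + 1)^2)) sums (8 * b / pi^2 * (pi^2 / 8))"
    by (rule sums_mult[OF alternating_odd_cosine_cube_series(2)])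
  ultimately show ?thesis by simp
qed

lemma abs_coef: "b > 0 \<Longrightarrow> \<bar>coef b n\<bar> = 16 * b^2 / pi^3 * (1 / (2 * real n + 1)^3)"
  by (simp add: coef_def freq_def abs_mult power_abs power2_eq_square power3_eq_cube)

lemma abs_coef_freq: "b > 0 \<Longrightarrow> \<bar>coef b n\<bar> * freq b n = 2 / (b * freq b n ^ 2)"
  using freq_pos[of b n] by (simp add: coef_def abs_mult power_abs power2_eq_square power3_eq_cube)

lemma summable_abs_coef: "b > 0 \<Longrightarrow> summable (\<lambda>n. \<bar>coef b n\<bar>)"
  unfolding abs_coef by (intro summable_mult summable_inverse_odd_cube)

lemma coef_cos_sums:
  assumes "b > 0" "\<bar>y\<bar> \<le> b"
  shows "(\<lambda>n. coef b n * cos (freq b n * y)) sums ((b^2 - y^2) / 2)"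
proof -
  define t where "t = pi / 2 / b * y"
  have t: "\<bar>t\<bar> \<le> pi / 2"
    using assms mult_left_mono[of "\<bar>y\<bar>" b "pi / 2 / b"] by (simp add: t_def abs_mult)
  have "coef b n * cos (freq b n * y)
      = 16 * b^2 / pi^3 * ((-1)^n * cos ((2 * real n + 1) * t) / (2 * real n + 1)^3)" for n
    using assms by (simp add: coef_def freq_def t_def power2_eq_square power3_eq_cube mult_ac)
  moreover have "(\<lambda>n. 16 * b^2 / pi^3 * ((-1)^n * cos ((2 * real n + 1) * t) / (2 * real n + 1)^3))
      sums (16 * b^2 / pi^3 * (pi / 8 * ((pi/2)^2 - t^2)))"
    by (rule sums_mult[OF alternating_odd_cosine_cube_series(1)[OF t]])
  moreover have "16 * b^2 / pi^3 * (pi / 8 * ((pi/2)^2 - t^2)) = (b^2 - y^2) / 2"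
    using assms by (simp add: t_def field_simps power2_eq_square power3_eq_cube)
  ultimately show ?thesis by (simp only:)
qed

text \<open>The terms have real part \<open>coef b n * cosh (k x) * cos (k y) / cosh (k a)\<close>
  with \<open>k = freq b n\<close>: the quotient of hyperbolic cosines is 1 on the vertical sides
  and the cosine vanishes on the horizontal ones. With a holomorphic series one complex derivative
  contains both partial derivatives.\<close>

definition torsion_potential :: "real \<Rightarrow> real \<Rightarrow> complex \<Rightarrow> complex" where
  "torsion_potential a b z =
     (\<Sum>n. of_real (coef b n / cosh (freq b n * a)) * cosh (of_real (freq b n) * z))"

definition torsion_potential' :: "real \<Rightarrow> real \<Rightarrow> complex \<Rightarrow> complex" where
  "torsion_potential' a b z =
     (\<Sum>n. of_real (coef b n * freq b n / cosh (freq b n * a)) * sinh (of_real (freq b n) * z))"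

section \<open>Convergence and differentiation of the potential on the closed strip\<close>

lemma convex_strip: "convex {z. \<bar>Re z\<bar> \<le> a}"
proof -
  have "{z. \<bar>Re z\<bar> \<le> a} = {z. Re z \<le> a} \<inter> {z. Re z \<ge> -a}" by auto
  then show ?thesis
    by (simp add: convex_Int convex_halfspace_Re_le convex_halfspace_Re_ge)
qed

lemma open_strip: "open {z. \<bar>Re z\<bar> < a}"
  by (intro open_Collect_less continuous_intros)

lemma norm_torsion_potential_term_le:
  assumes "b > 0" "\<bar>Re z\<bar> \<le> a"
  shows "norm (of_real (coef b n / cosh (freq b n * a)) * cosh (of_real (freq b n) * z)) \<le> \<bar>coef b n\<bar>"
proof -
  have "norm (cosh (of_real (freq b n) * z)) \<le> cosh (freq b n * a)"
    using norm_cosh_le[of "of_real (freq b n) * z"] assms freq_pos[OF assms(1), of n]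
      cosh_le_cosh_real[of "freq b n * Re z" "freq b n * a"]
    by (simp add: abs_mult)
  then have "\<bar>coef b n\<bar> * norm (cosh (of_real (freq b n) * z)) \<le> \<bar>coef b n\<bar> * cosh (freq b n * a)"
    by (simp add: mult_left_mono)
  then show ?thesis
    by (simp add: norm_mult norm_divide divide_simps)
qed

text \<open>On the closed strip the hyperbolic sine is dominated by
  \<open>cosh (freq b n * a)\<close>, which leaves \<open>\<bar>coef b n\<bar> * freq b n\<close>, a
  summable majorant up to the edges.\<close>

lemma norm_torsion_potential'_term_le:
  assumes "b > 0" "\<bar>Re z\<bar> \<le> a"
  shows "norm (of_real (coef b n * freq b n / cosh (freq b n * a)) * sinh (of_real (freq b n) * z))
      \<le> 2 / (b * freq b n ^ 2)"
proof -
  have "norm (sinh (of_real (freq b n) * z)) \<le> cosh (freq b n * a)"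
    using norm_sinh_le[of "of_real (freq b n) * z"] assms freq_pos[OF assms(1), of n]
      cosh_le_cosh_real[of "freq b n * Re z" "freq b n * a"]
    by (simp add: abs_mult)
  then have "\<bar>coef b n\<bar> * freq b n * norm (sinh (of_real (freq b n) * z))
      \<le> \<bar>coef b n\<bar> * freq b n * cosh (freq b n * a)"
    using freq_pos[OF assms(1), of n] by (simp add: mult_left_mono)
  then show ?thesis
    unfolding abs_coef_freq[OF assms(1), symmetric] using freq_pos[OF assms(1), of n]
    by (simp add: norm_mult norm_divide divide_simps)
qed

lemma torsion_potential_sums:
  assumes "b > 0" "\<bar>Re z\<bar> \<le> a"
  shows "(\<lambda>n. of_real (coef b n / cosh (freq b n * a)) * cosh (of_real (freq b n) * z))
      sums torsion_potential a b z"
  unfolding torsion_potential_def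
  by (rule summable_sums, rule summable_comparison_test'[OF summable_abs_coef[OF assms(1)], of 0])
    (rule norm_torsion_potential_term_le[OF assms])

lemma torsion_potential'_sums:
  assumes "b > 0" "\<bar>Re z\<bar> \<le> a"
  shows "(\<lambda>n. of_real (coef b n * freq b n / cosh (freq b n * a)) * sinh (of_real (freq b n) * z))
      sums torsion_potential' a b z"
  unfolding torsion_potential'_def
  by (rule summable_sums, rule summable_comparison_test'[OF sums_summable[OF freq_square_sums[OF assms(1)]], of 0])
    (rule norm_torsion_potential'_term_le[OF assms])

lemma torsion_potential'_uniform_limit:
  assumes "b > 0"
  shows "uniform_limit {z. \<bar>Re z\<bar> \<le> a}
    (\<lambda>N z. \<Sum>n<N. of_real (coef b n * freq b n / cosh (freq b n * a)) * sinh (of_real (freq b n) * z))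
    (torsion_potential' a b) sequentially"
  unfolding torsion_potential'_def
  by (rule Weierstrass_m_test[OF _ sums_summable[OF freq_square_sums[OF assms(1)]]])
    (rule norm_torsion_potential'_term_le[OF assms], simp)

lemma continuous_on_torsion_potential':
  assumes "b > 0"
  shows "continuous_on {z. \<bar>Re z\<bar> \<le> a} (torsion_potential' a b)"
  by (rule uniform_limit_theorem[OF _ torsion_potential'_uniform_limit[OF assms]])
    (auto intro!: continuous_intros always_eventually)

text \<open>Differentiating termwise within the closed strip, which is convex, covers the vertical
  sides as well.\<close>

lemma torsion_potential_has_field_derivative:
  assumes "b > 0" "\<bar>Re z\<bar> \<le> a"
  shows "(torsion_potential a b has_field_derivative torsion_potential' a b z)
    (at z within {z. \<bar>Re z\<bar> \<le> a})"
proof -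
  let ?S = "{z. \<bar>Re z\<bar> \<le> a}"
  have "((\<lambda>z. of_real (coef b n / cosh (freq b n * a)) * cosh (of_real (freq b n) * z)) has_field_derivative
      of_real (coef b n * freq b n / cosh (freq b n * a)) * sinh (of_real (freq b n) * w)) (at w within ?S)"
    for n w
    by (auto intro!: derivative_eq_intros)
  from has_field_derivative_series[OF convex_strip this torsion_potential'_uniform_limit[OF assms(1)], of z]
  obtain g where g: "\<And>x. x \<in> ?S \<Longrightarrow>
        (\<lambda>n. of_real (coef b n / cosh (freq b n * a)) * cosh (of_real (freq b n) * x)) sums g x"
      "\<And>x. x \<in> ?S \<Longrightarrow> (g has_field_derivative torsion_potential' a b x) (at x within ?S)"
    using sums_summable[OF torsion_potential_sums[OF assms]] assms(2) by auto
  have "g x = torsion_potential a b x" if "x \<in> ?S" for x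
    using g(1)[OF that] torsion_potential_sums[OF assms(1), of x a] that sums_unique2 by blast
  then show ?thesis
    using g(2)[of z] assms(2) by (auto elim: has_field_derivative_transform_within[where d = 1])
qed

text \<open>As the derivative of a holomorphic function it is holomorphic, so further derivatives
  exist in the open strip without differentiating the series again.\<close>

lemma torsion_potential'_holomorphic:
  assumes "b > 0"
  shows "torsion_potential' a b holomorphic_on {z. \<bar>Re z\<bar> < a}"
proof -
  have 1: "(torsion_potential a b has_field_derivative torsion_potential' a b z) (at z)"
    if "z \<in> {z. \<bar>Re z\<bar> < a}" for z
  proof -
    have "(torsion_potential a b has_field_derivative torsion_potential' a b z) (at z within {z. \<bar>Re z\<bar> < a})"
      by (rule has_field_derivative_subset[OF torsion_potential_has_field_derivative[OF assms]])
        (use that in auto)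
    then show ?thesis
      by (simp only: at_within_open[OF that open_strip])
  qed
  then have "torsion_potential a b holomorphic_on {z. \<bar>Re z\<bar> < a}"
    unfolding holomorphic_on_def field_differentiable_def by (blast intro: has_field_derivative_at_within)
  from holomorphic_deriv[OF this open_strip] show ?thesis
    by (rule holomorphic_transform) (use 1 in \<open>auto dest: DERIV_imp_deriv\<close>)
qed

lemma Re_torsion_potential_vertical:
  assumes "a > 0" "b > 0" "\<bar>Re z\<bar> = a" "\<bar>Im z\<bar> \<le> b"
  shows "Re (torsion_potential a b z) = (b^2 - (Im z)^2) / 2"
proof -
  have "coef b n * (cosh (freq b n * Re z) * cos (freq b n * Im z)) / cosh (freq b n * a)
      = coef b n * cos (freq b n * Im z)" for n
  proof -
    have "cosh (freq b n * Re z) = cosh (freq b n * a)"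
      using assms(3) by (metis cosh_real_abs abs_mult abs_abs)
    then show ?thesis by (simp del: cosh_real_eq_iff)
  qed
  then have "(\<lambda>n. coef b n * cos (freq b n * Im z)) sums Re (torsion_potential a b z)"
    using sums_Re[OF torsion_potential_sums[OF assms(2), of z a]] assms(3) by (simp add: Re_cosh)
  then show ?thesis
    using coef_cos_sums[OF assms(2,4)] sums_unique2 by blast
qed

lemma Re_torsion_potential_horizontal:
  assumes "b > 0" "\<bar>Re z\<bar> \<le> a" "\<bar>Im z\<bar> = b"
  shows "Re (torsion_potential a b z) = 0"
  using sums_Re[OF torsion_potential_sums[OF assms(1,2)]] assms
  by (simp add: Re_cosh cos_freq) (metis sums_unique2 sums_zero)

text \<open>This is the length of the gradient at the points of the horizontal sides with first
  coordinate \<open>x\<close>, which is also the inward normal derivative there.\<close>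

definition side_slope :: "real \<Rightarrow> real \<Rightarrow> real \<Rightarrow> real" where
  "side_slope a b x = (\<Sum>n. 2 / (b * freq b n ^ 2) * (1 - cosh (freq b n * x) / cosh (freq b n * a)))"

lemma summable_side_slope:
  assumes "b > 0" "\<bar>x\<bar> \<le> a"
  shows "summable (\<lambda>n. 2 / (b * freq b n ^ 2) * (1 - cosh (freq b n * x) / cosh (freq b n * a)))"
proof (rule summable_comparison_test'[OF sums_summable[OF freq_square_sums[OF assms(1)]], of 0])
  fix n
  have "cosh (freq b n * x) \<le> cosh (freq b n * a)"
    using assms freq_pos[OF assms(1), of n] by (intro cosh_le_cosh_real) (auto simp: abs_mult)
  then have "\<bar>1 - cosh (freq b n * x) / cosh (freq b n * a)\<bar> \<le> 1"
    by (simp add: abs_if divide_simps)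
  then show "norm (2 / (b * freq b n ^ 2) * (1 - cosh (freq b n * x) / cosh (freq b n * a)))
      \<le> 2 / (b * freq b n ^ 2)"
    using assms(1) mult_left_le[of "\<bar>1 - cosh (freq b n * x) / cosh (freq b n * a)\<bar>" "2 / (b * freq b n ^ 2)"]
    by (simp add: abs_mult del: right_diff_distrib_numeral)
qed

lemma side_slope_nonneg:
  assumes "b > 0" "\<bar>x\<bar> \<le> a"
  shows "0 \<le> side_slope a b x"
  unfolding side_slope_def
proof (rule suminf_nonneg[OF summable_side_slope[OF assms]])
  fix n
  have "cosh (freq b n * x) \<le> cosh (freq b n * a)"
    using assms freq_pos[OF assms(1), of n] by (intro cosh_le_cosh_real) (auto simp: abs_mult)
  then show "0 \<le> 2 / (b * freq b n ^ 2) * (1 - cosh (freq b n * x) / cosh (freq b n * a))"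
    using assms(1) by (simp del: right_diff_distrib_numeral)
qed

text \<open>Each single term is strictly larger at 0, because \<open>cosh\<close> exceeds 1 away
  from 0.\<close>

lemma side_slope_less_middle:
  assumes "b > 0" "\<bar>x\<bar> \<le> a" "x \<noteq> 0"
  shows "side_slope a b x < side_slope a b 0"
proof -
  let ?f = "\<lambda>x n. 2 / (b * freq b n ^ 2) * (1 - cosh (freq b n * x) / cosh (freq b n * a))"
  have s: "summable (?f x)" "summable (?f 0)"
    using summable_side_slope[OF assms(1), of x a] summable_side_slope[OF assms(1), of 0 a] assms(2) by auto
  have "0 < ?f 0 n - ?f x n" for n
  proof -
    have "cosh (freq b n * x) > 1"
      using cosh_real_ge_1[of "freq b n * x"] cosh_real_one_iff[of "freq b n * x"]
        freq_pos[OF assms(1), of n] assms(3) by (simp add: order_less_le)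
    then have "1 / cosh (freq b n * a) < cosh (freq b n * x) / cosh (freq b n * a)"
      by (simp add: divide_strict_right_mono)
    then have "?f x n < ?f 0 n"
      using assms(1) freq_pos[OF assms(1), of n] by (intro mult_strict_left_mono) auto
    then show ?thesis by simp
  qed
  then have "0 < (\<Sum>n. ?f 0 n - ?f x n)"
    by (intro suminf_pos summable_diff s)
  then show ?thesis
    unfolding side_slope_def using suminf_diff[OF s(2,1)] by simp
qed

text \<open>On these sides the cosines vanish and the sines are signs. Writing \<open>Im z\<close>
  as its sign times the series of \<open>freq_square_sums\<close> produces the factors
  \<open>1 - cosh / cosh\<close> of \<open>side_slope\<close>.\<close>

lemma torsion_potential'_horizontal:
  assumes "b > 0" "\<bar>Re z\<bar> \<le> a" "\<bar>Im z\<bar> = b"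
  shows "Re (torsion_potential' a b z) = 0"
    and "Im (torsion_potential' a b z) - Im z = - sgn (Im z) * side_slope a b (Re z)"
proof -
  note s = torsion_potential'_sums[OF assms(1,2)]
  show "Re (torsion_potential' a b z) = 0"
    using sums_Re[OF s] assms by (simp add: Re_sinh cos_freq) (metis sums_unique2 sums_zero)
  have "Im (of_real (coef b n * freq b n / cosh (freq b n * a)) * sinh (of_real (freq b n) * z))
     = sgn (Im z) * (2 / (b * freq b n ^ 2) * (cosh (freq b n * Re z) / cosh (freq b n * a)))" for n
    using freq_pos[OF assms(1), of n] sin_freq[OF assms(1,3), of n]
    by (simp add: Im_sinh coef_def power2_eq_square power3_eq_cube flip: power_add mult_2)
  then have 1: "(\<lambda>n. sgn (Im z) * (2 / (b * freq b n ^ 2) * (cosh (freq b n * Re z) / cosh (freq b n * a))))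
      sums Im (torsion_potential' a b z)"
    using sums_Im[OF s] by simp
  have "(\<lambda>n. sgn (Im z) * (2 / (b * freq b n ^ 2) * (1 - cosh (freq b n * Re z) / cosh (freq b n * a))))
      sums (sgn (Im z) * side_slope a b (Re z))"
    unfolding side_slope_def by (intro sums_mult summable_sums summable_side_slope assms)
  from sums_add[OF 1 this] have "(\<lambda>n. sgn (Im z) * (2 / (b * freq b n ^ 2)))
      sums (Im (torsion_potential' a b z) + sgn (Im z) * side_slope a b (Re z))"
    by (simp add: algebra_simps)
  moreover have "(\<lambda>n. sgn (Im z) * (2 / (b * freq b n ^ 2))) sums (sgn (Im z) * b)"
    by (intro sums_mult freq_square_sums assms)
  moreover have "sgn (Im z) * b = Im z"
    using assms(3) by (metis sgn_mult_abs)
  ultimately show "Im (torsion_potential' a b z) - Im z = - sgn (Im z) * side_slope a b (Re z)"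
    using sums_unique2 by fastforce
qed

section \<open>The explicit solution in a rotated and translated frame\<close>

definition rect_torsion :: "real \<Rightarrow> real \<Rightarrow> complex \<Rightarrow> real" where
  "rect_torsion a b z = (b^2 - (Im z)^2) / 2 - Re (torsion_potential a b z)"

text \<open>No orientation of the frame is prescribed: \<open>coords \<i> 1 c\<close> is a
  reflection, and serves both to exchange the two side lengths and to reflect across a diagonal
  line.\<close>

definition coords :: "'a::euclidean_space \<Rightarrow> 'a \<Rightarrow> 'a \<Rightarrow> 'a \<Rightarrow> complex" where
  "coords e1 e2 c q = Complex ((q - c) \<bullet> e1) ((q - c) \<bullet> e2)"

text \<open>By the Cauchy-Riemann equations the y-derivative of the real part of the potential is
  minus the imaginary part of its complex derivative, hence the plus sign in the second
  component.\<close>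

definition rect_torsion_grad :: "real \<Rightarrow> real \<Rightarrow> 'a::euclidean_space \<Rightarrow> 'a \<Rightarrow> complex \<Rightarrow> 'a" where
  "rect_torsion_grad a b e1 e2 z =
     - Re (torsion_potential' a b z) *\<^sub>R e1 + (Im (torsion_potential' a b z) - Im z) *\<^sub>R e2"

definition grad_square :: "real \<Rightarrow> real \<Rightarrow> complex \<Rightarrow> real" where
  "grad_square a b z = (Re (torsion_potential' a b z))^2 + (Im (torsion_potential' a b z) - Im z)^2"

text \<open>The expansion clause forces dimension two, so that one notion serves for
  \<open>real^2\<close> and for the complex plane.\<close>

definition orthonormal_frame :: "'a::euclidean_space \<Rightarrow> 'a \<Rightarrow> bool" where
  "orthonormal_frame e1 e2 \<longleftrightarrow> e1 \<bullet> e1 = 1 \<and> e2 \<bullet> e2 = 1 \<and> e1 \<bullet> e2 = 0 \<and>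
     (\<forall>q. q = (q \<bullet> e1) *\<^sub>R e1 + (q \<bullet> e2) *\<^sub>R e2)"

definition open_rect :: "real \<Rightarrow> real \<Rightarrow> 'a::euclidean_space \<Rightarrow> 'a \<Rightarrow> 'a \<Rightarrow> 'a set" where
  "open_rect a b e1 e2 c = {q. \<bar>Re (coords e1 e2 c q)\<bar> < a \<and> \<bar>Im (coords e1 e2 c q)\<bar> < b}"

lemma Re_coords [simp]: "Re (coords e1 e2 c q) = (q - c) \<bullet> e1"
  and Im_coords [simp]: "Im (coords e1 e2 c q) = (q - c) \<bullet> e2"
  by (simp_all add: coords_def)

lemma orthonormal_frame_complex: "orthonormal_frame 1 \<i>" "orthonormal_frame \<i> 1"
  by (auto simp: orthonormal_frame_def inner_complex_def complex_eq_iff)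

lemma coords_complex: "coords 1 \<i> 0 z = z"
  by (simp add: complex_eq_iff inner_complex_def)

lemma coords_has_derivative:
  "(coords e1 e2 c has_derivative (\<lambda>h. Complex (h \<bullet> e1) (h \<bullet> e2))) (at q within S)"
proof -
  have "((\<lambda>q. of_real ((q - c) \<bullet> e1) + \<i> * of_real ((q - c) \<bullet> e2)) has_derivative
      (\<lambda>h. of_real (h \<bullet> e1) + \<i> * of_real (h \<bullet> e2))) (at q within S)"
    by (auto intro!: derivative_eq_intros)
  then show ?thesis by (simp add: coords_def[abs_def] Complex_eq)
qed

lemma continuous_on_coords: "continuous_on S (coords e1 e2 c)"
  using coords_has_derivative by (rule has_derivative_continuous_on)

lemma norm_rect_torsion_grad:
  assumes "orthonormal_frame e1 e2"
  shows "(norm (rect_torsion_grad a b e1 e2 z))^2 = grad_square a b z"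
  using assms
  unfolding power2_norm_eq_inner orthonormal_frame_def rect_torsion_grad_def grad_square_def
  by (simp add: inner_add_left inner_add_right inner_commute power2_eq_square inner_diff_left
      inner_diff_right)

lemma rect_torsion_has_derivative:
  assumes "b > 0" "coords e1 e2 c ` S \<subseteq> {z. \<bar>Re z\<bar> \<le> a}" "q \<in> S"
  shows "((\<lambda>q. rect_torsion a b (coords e1 e2 c q)) has_derivative
    (\<lambda>h. rect_torsion_grad a b e1 e2 (coords e1 e2 c q) \<bullet> h)) (at q within S)"
proof -
  let ?z = "coords e1 e2 c q" and ?T = "torsion_potential' a b (coords e1 e2 c q)"
  have "(torsion_potential a b has_derivative (\<lambda>h. ?T * h)) (at ?z within coords e1 e2 c ` S)"
    unfolding has_field_derivative_def[symmetric]
    by (rule has_field_derivative_subset[OF torsion_potential_has_field_derivative[OF assms(1)] assms(2)])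
      (use assms(2,3) in blast)
  from diff_chain_within[OF coords_has_derivative this]
  have "((\<lambda>q. torsion_potential a b (coords e1 e2 c q)) has_derivative
      (\<lambda>h. ?T * Complex (h \<bullet> e1) (h \<bullet> e2))) (at q within S)"
    by (simp add: o_def)
  note d = has_derivative_Re[OF this]
  have "((\<lambda>q. (b^2 - (Im (coords e1 e2 c q))^2) / 2) has_derivative
      (\<lambda>h. - (Im ?z * (h \<bullet> e2)))) (at q within S)"
    unfolding Im_coords by (auto intro!: derivative_eq_intros)
  from has_derivative_diff[OF this d] show ?thesis
    unfolding rect_torsion_def
    by (rule has_derivative_eq_rhs)
      (simp add: fun_eq_iff rect_torsion_grad_def inner_diff_left inner_add_left inner_commute algebra_simps)
qed

lemma continuous_on_rect_torsion:
  assumes "b > 0" "coords e1 e2 c ` S \<subseteq> {z. \<bar>Re z\<bar> \<le> a}"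
  shows "continuous_on S (\<lambda>q. rect_torsion a b (coords e1 e2 c q))"
  using rect_torsion_has_derivative[OF assms] by (rule has_derivative_continuous_on)

text \<open>The real part of the potential is harmonic, and the parabola contributes -1.\<close>

lemma rect_torsion_has_laplacian:
  assumes "b > 0" "orthonormal_frame e1 e2" "coords e1 e2 c ` S \<subseteq> {z. \<bar>Re z\<bar> < a}" "open S"
  shows "has_laplacian_on (\<lambda>q. rect_torsion a b (coords e1 e2 c q)) (\<lambda>_. -1) S"
proof -
  let ?T = "torsion_potential' a b" and ?z = "coords e1 e2 c"
  define D where "D q = deriv ?T (?z q)" for q
  define A where "A q h = - Re (D q * Complex (h \<bullet> e1) (h \<bullet> e2)) *\<^sub>R e1
      + (Im (D q * Complex (h \<bullet> e1) (h \<bullet> e2)) - h \<bullet> e2) *\<^sub>R e2" for q h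
  have "coords e1 e2 c ` S \<subseteq> {z. \<bar>Re z\<bar> \<le> a}"
    using assms(3) by fastforce
  then have "((\<lambda>q. rect_torsion a b (?z q)) has_derivative
      (\<lambda>h. rect_torsion_grad a b e1 e2 (?z q) \<bullet> h)) (at q)" if "q \<in> S" for q
    using rect_torsion_has_derivative[OF assms(1), of e1 e2 c S a q] that
    unfolding at_within_open[OF that assms(4)] by blast
  moreover have "((\<lambda>q. rect_torsion_grad a b e1 e2 (?z q)) has_derivative A q) (at q)" if "q \<in> S" for q
  proof -
    have "(?T has_derivative (\<lambda>h. D q * h)) (at (?z q))"
      unfolding D_def has_field_derivative_def[symmetric]
      by (rule holomorphic_derivI[OF torsion_potential'_holomorphic[OF assms(1)] open_strip])
        (use assms(3) that in blast)
    from has_derivative_compose[OF coords_has_derivative this]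
    have "((\<lambda>q. ?T (?z q)) has_derivative (\<lambda>h. D q * Complex (h \<bullet> e1) (h \<bullet> e2))) (at q)" .
    note d = has_derivative_Re[OF this] has_derivative_Im[OF this]
    show ?thesis
      unfolding rect_torsion_grad_def A_def Im_coords
      by (rule has_derivative_eq_rhs, (rule derivative_intros d)+) (simp add: fun_eq_iff)
  qed
  moreover have "-1 = (\<Sum>e\<in>Basis. A q e \<bullet> e)" for q
  proof -
    \<comment> \<open>Expanding into products of coordinates turns the trace over the standard basis
      into inner products of \<open>e1\<close> and \<open>e2\<close>; the mixed term drops out by
      orthogonality and the two \<open>Re (D q)\<close> terms cancel.\<close>
    have "A q e \<bullet> e = - Re (D q) * ((e1 \<bullet> e) * (e1 \<bullet> e)) + 2 * Im (D q) * ((e1 \<bullet> e) * (e2 \<bullet> e))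
        + (Re (D q) - 1) * ((e2 \<bullet> e) * (e2 \<bullet> e))" for e
      by (simp add: A_def inner_add_left inner_diff_left inner_commute[of e] algebra_simps)
    then have "(\<Sum>e\<in>Basis. A q e \<bullet> e)
        = - Re (D q) * (e1 \<bullet> e1) + 2 * Im (D q) * (e1 \<bullet> e2) + (Re (D q) - 1) * (e2 \<bullet> e2)"
      by (simp add: sum.distrib sum_subtractf sum_distrib_left[symmetric] sum_negf
          euclidean_inner[of e1 e1] euclidean_inner[of e1 e2] euclidean_inner[of e2 e2])
    then show ?thesis using assms(2) by (simp add: orthonormal_frame_def)
  qed
  ultimately show ?thesis
    unfolding has_laplacian_on_def
    by (intro exI[of _ "\<lambda>q. rect_torsion_grad a b e1 e2 (?z q)"] exI[of _ A]) blast
qed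

lemma rect_torsion_boundary:
  assumes "a > 0" "b > 0" "\<bar>Re z\<bar> \<le> a" "\<bar>Im z\<bar> \<le> b" "\<bar>Re z\<bar> = a \<or> \<bar>Im z\<bar> = b"
  shows "rect_torsion a b z = 0"
proof (cases "\<bar>Im z\<bar> = b")
  case True
  then have "(Im z)^2 = b^2" by auto
  then show ?thesis
    using Re_torsion_potential_horizontal[OF assms(2,3) True] by (simp add: rect_torsion_def)
next
  case False
  then show ?thesis
    using Re_torsion_potential_vertical[OF assms(1,2) _ assms(4)] assms(5) by (simp add: rect_torsion_def)
qed

section \<open>Closure, boundedness and frontier of the rectangle, and uniqueness of the
  solution\<close>

lemma open_open_rect: "open (open_rect a b e1 e2 c)"
  unfolding open_rect_def coords_def complex.sel
  by (intro open_Collect_conj open_Collect_less continuous_intros)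

lemma closure_open_rect:
  assumes "a > 0" "b > 0"
  shows "closure (open_rect a b e1 e2 c) =
    {q. \<bar>Re (coords e1 e2 c q)\<bar> \<le> a \<and> \<bar>Im (coords e1 e2 c q)\<bar> \<le> b}" (is "_ = ?C")
proof
  have "closed ?C"
    unfolding coords_def complex.sel by (intro closed_Collect_conj closed_Collect_le continuous_intros)
  then show "closure (open_rect a b e1 e2 c) \<subseteq> ?C"
    by (intro closure_minimal) (auto simp: open_rect_def)
  show "?C \<subseteq> closure (open_rect a b e1 e2 c)"
  proof
    fix q assume q: "q \<in> ?C"
    \<comment> \<open>Contracting towards the centre \<open>c\<close> moves a point of the closed
      rectangle into the open one.\<close>
    define f where "f n = c + (1 - inverse (real (Suc n))) *\<^sub>R (q - c)" for n
    have shrink: "\<bar>(1 - inverse (real (Suc n))) * x\<bar> < r" if "\<bar>x\<bar> \<le> r" "r > 0" for x r :: real and n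
    proof -
      have "\<bar>(1 - inverse (real (Suc n))) * x\<bar> = (1 - inverse (real (Suc n))) * \<bar>x\<bar>"
        by (simp add: abs_mult inverse_eq_divide)
      also have "\<dots> \<le> (1 - inverse (real (Suc n))) * r"
        using that by (intro mult_left_mono) (auto simp: inverse_eq_divide)
      also have "\<dots> < 1 * r" using that by (intro mult_strict_right_mono) auto
      finally show ?thesis by simp
    qed
    have "f n \<in> open_rect a b e1 e2 c" for n
      using q shrink assms by (simp add: open_rect_def f_def del: of_nat_Suc)
    moreover have "f \<longlonglongrightarrow> c + (1 - 0) *\<^sub>R (q - c)"
      unfolding f_def by (intro tendsto_intros LIMSEQ_inverse_real_of_nat)
    ultimately show "q \<in> closure (open_rect a b e1 e2 c)"
      unfolding closure_sequential by (intro exI[of _ f]) simp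
  qed
qed

lemma bounded_open_rect:
  assumes "orthonormal_frame e1 e2"
  shows "bounded (open_rect a b e1 e2 c)"
proof (rule boundedI)
  fix q assume q: "q \<in> open_rect a b e1 e2 c"
  have "norm e1 = 1" "norm e2 = 1"
    using assms by (auto simp: orthonormal_frame_def norm_eq_1)
  moreover have "q - c = ((q - c) \<bullet> e1) *\<^sub>R e1 + ((q - c) \<bullet> e2) *\<^sub>R e2"
    using assms unfolding orthonormal_frame_def by blast
  ultimately have "norm (q - c) \<le> \<bar>(q - c) \<bullet> e1\<bar> + \<bar>(q - c) \<bullet> e2\<bar>"
    by (metis norm_triangle_ineq norm_scaleR mult.right_neutral)
  then have "norm (q - c) \<le> a + b"
    using q by (simp add: open_rect_def)
  then show "norm q \<le> norm c + (a + b)"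
    using norm_triangle_sub[of q c] by linarith
qed

lemma frontier_open_rect:
  assumes "a > 0" "b > 0" "q \<in> frontier (open_rect a b e1 e2 c)"
  shows "\<bar>Re (coords e1 e2 c q)\<bar> \<le> a" "\<bar>Im (coords e1 e2 c q)\<bar> \<le> b"
    "\<bar>Re (coords e1 e2 c q)\<bar> = a \<or> \<bar>Im (coords e1 e2 c q)\<bar> = b"
  using assms(3)
  unfolding frontier_def closure_open_rect[OF assms(1,2)] interior_open[OF open_open_rect]
  by (auto simp: open_rect_def)

lemma torsion_problem_solution_eq:
  assumes "a > 0" "b > 0" "orthonormal_frame e1 e2"
    and "continuous_on (closure (open_rect a b e1 e2 c)) u"
    and "has_laplacian_on u (\<lambda>_. -1) (open_rect a b e1 e2 c)"
    and "\<And>q. q \<in> frontier (open_rect a b e1 e2 c) \<Longrightarrow> u q = 0"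
    and "q \<in> closure (open_rect a b e1 e2 c)"
  shows "u q = rect_torsion a b (coords e1 e2 c q)"
proof (rule dirichlet_problem_unique[OF open_open_rect bounded_open_rect[OF assms(3)] assms(4) _ assms(5)])
  show "continuous_on (closure (open_rect a b e1 e2 c)) (\<lambda>q. rect_torsion a b (coords e1 e2 c q))"
    by (rule continuous_on_rect_torsion) (auto simp: assms closure_open_rect)
  show "has_laplacian_on (\<lambda>q. rect_torsion a b (coords e1 e2 c q)) (\<lambda>_. -1) (open_rect a b e1 e2 c)"
    by (rule rect_torsion_has_laplacian[OF assms(2,3) _ open_open_rect]) (auto simp: open_rect_def)
  show "u q = rect_torsion a b (coords e1 e2 c q)" if "q \<in> frontier (open_rect a b e1 e2 c)" for q
    using assms(6)[OF that] rect_torsion_boundary[OF assms(1,2) frontier_open_rect[OF assms(1,2) that]]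
    by simp
qed (use assms in auto)

text \<open>The negative of the solution has Laplacian 1 and vanishes on the frontier, so the
  maximum principle applies. The sign decides the boundary comparison in the reflection
  argument.\<close>

lemma rect_torsion_nonneg:
  assumes "a > 0" "b > 0" "\<bar>Re z\<bar> \<le> a" "\<bar>Im z\<bar> \<le> b"
  shows "rect_torsion a b z \<ge> 0"
proof -
  have lap0: "has_laplacian_on (\<lambda>_. 0) (\<lambda>_. 0) S" for S :: "complex set"
    unfolding has_laplacian_on_def
    by (intro exI[of _ "\<lambda>_. 0"] exI[of _ "\<lambda>_ _. 0"]) (simp add: inner_zero_left[abs_def])
  let ?R = "open_rect a b 1 \<i> 0"
  have "0 - rect_torsion a b (coords 1 \<i> 0 z) \<le> 0"
  proof (rule weak_maximum_principle[OF open_open_rect bounded_open_rect[OF orthonormal_frame_complex(1)]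
        _ has_laplacian_on_diff[OF lap0 rect_torsion_has_laplacian[OF assms(2) orthonormal_frame_complex(1) _ open_open_rect]]])
    show "continuous_on (closure ?R) (\<lambda>q. 0 - rect_torsion a b (coords 1 \<i> 0 q))"
      by (intro continuous_intros continuous_on_rect_torsion) (auto simp: assms closure_open_rect)
    show "z \<in> closure ?R"
      using assms by (simp add: closure_open_rect coords_complex del: Re_coords Im_coords)
    show "0 - rect_torsion a b (coords 1 \<i> 0 q) \<le> 0" if "q \<in> frontier ?R" for q
      using rect_torsion_boundary[OF assms(1,2) frontier_open_rect[OF assms(1,2) that]] by simp
  qed (auto simp: open_rect_def)
  then show ?thesis by (simp add: coords_complex)
qed

text \<open>Expanding in the other variable solves the same Dirichlet problem, so both series agree.
  The swapped series gives access to the vertical sides.\<close>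

lemma rect_torsion_swap:
  assumes "a > 0" "b > 0" "\<bar>Re z\<bar> \<le> a" "\<bar>Im z\<bar> \<le> b"
  shows "rect_torsion b a (coords \<i> 1 0 z) = rect_torsion a b z"
proof -
  have sw: "Re (coords \<i> 1 0 q) = Im q" "Im (coords \<i> 1 0 q) = Re q"
      "Re (coords 1 \<i> 0 q) = Re q" "Im (coords 1 \<i> 0 q) = Im q" for q
    by (simp_all add: inner_complex_def)
  let ?R = "open_rect a b 1 \<i> 0"
  have "rect_torsion b a (coords \<i> 1 0 z) = rect_torsion a b (coords 1 \<i> 0 z)"
  proof (rule torsion_problem_solution_eq[OF assms(1,2) orthonormal_frame_complex(1)])
    show "continuous_on (closure ?R) (\<lambda>q. rect_torsion b a (coords \<i> 1 0 q))"
      by (rule continuous_on_rect_torsion)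
        (auto simp: assms closure_open_rect sw simp del: Re_coords Im_coords)
    show "has_laplacian_on (\<lambda>q. rect_torsion b a (coords \<i> 1 0 q)) (\<lambda>_. -1) ?R"
      by (rule rect_torsion_has_laplacian[OF assms(1) orthonormal_frame_complex(2) _ open_open_rect])
        (auto simp: open_rect_def sw simp del: Re_coords Im_coords)
    show "rect_torsion b a (coords \<i> 1 0 q) = 0" if "q \<in> frontier ?R" for q
      using frontier_open_rect[OF assms(1,2) that] unfolding sw
      by (intro rect_torsion_boundary assms) (auto simp only: sw)
    show "z \<in> closure ?R"
      using assms by (simp add: closure_open_rect sw del: Re_coords Im_coords)
  qed
  then show ?thesis by (simp add: coords_complex)
qed

section \<open>The gradient on the boundary and in the interior\<close>

lemma coords_swap: "coords \<i> 1 c z = Complex (Im z - Im c) (Re z - Re c)"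
  by (simp add: complex_eq_iff inner_complex_def)

lemma closed_rect_complex:
  assumes "a > 0" "b > 0"
  shows "closure (open_rect a b 1 \<i> 0) = {z. \<bar>Re z\<bar> \<le> a \<and> \<bar>Im z\<bar> \<le> b}"
  using closure_open_rect[OF assms, of 1 \<i> 0] by (simp only: coords_complex)

lemma convex_open_rect: "convex (open_rect a b e1 e2 c)"
proof -
  have "open_rect a b e1 e2 c = {q. e1 \<bullet> q < a + e1 \<bullet> c} \<inter> {q. e1 \<bullet> q > e1 \<bullet> c - a}
      \<inter> ({q. e2 \<bullet> q < b + e2 \<bullet> c} \<inter> {q. e2 \<bullet> q > e2 \<bullet> c - b})"
    by (auto simp: open_rect_def abs_less_iff inner_diff_left inner_commute[of e1] inner_commute[of e2])
  then show ?thesis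
    by (simp only: convex_Int convex_halfspace_lt convex_halfspace_gt)
qed

lemma interior_closure_open_rect:
  assumes "a > 0" "b > 0"
  shows "interior (closure (open_rect a b e1 e2 c)) \<noteq> {}"
proof -
  have "c \<in> open_rect a b e1 e2 c" using assms by (simp add: open_rect_def)
  then show ?thesis using interior_maximal[OF closure_subset open_open_rect] by blast
qed

lemma grad_square_horizontal:
  assumes "b > 0" "\<bar>Re z\<bar> \<le> a" "\<bar>Im z\<bar> = b"
  shows "grad_square a b z = (side_slope a b (Re z))^2"
proof -
  have "(sgn (Im z))^2 = 1" using assms by (auto simp: sgn_if)
  then show ?thesis
    unfolding grad_square_def torsion_potential'_horizontal[OF assms] by (simp add: power_mult_distrib)
qed

text \<open>The two expansions agree on the closed rectangle, so by uniqueness of the one-sided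
  gradient their gradients agree there too, including on the sides.\<close>

lemma grad_square_swap:
  assumes "a > 0" "b > 0" "\<bar>Re z\<bar> \<le> a" "\<bar>Im z\<bar> \<le> b"
  shows "grad_square a b z = grad_square b a (Complex (Im z) (Re z))"
proof -
  let ?R = "{z. \<bar>Re z\<bar> \<le> a \<and> \<bar>Im z\<bar> \<le> b}"
  have z: "z \<in> ?R" using assms by simp
  have 1: "(rect_torsion a b has_derivative (\<lambda>h. rect_torsion_grad a b 1 \<i> z \<bullet> h)) (at z within ?R)"
    using rect_torsion_has_derivative[OF assms(2) _ z, of 1 \<i> 0 a] by (auto simp: coords_complex)
  have "((\<lambda>q. rect_torsion b a (coords \<i> 1 0 q)) has_derivative
      (\<lambda>h. rect_torsion_grad b a \<i> 1 (coords \<i> 1 0 z) \<bullet> h)) (at z within ?R)"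
    by (rule rect_torsion_has_derivative[OF assms(1) _ z]) (auto simp: coords_swap)
  then have 2: "(rect_torsion a b has_derivative
      (\<lambda>h. rect_torsion_grad b a \<i> 1 (coords \<i> 1 0 z) \<bullet> h)) (at z within ?R)"
    by (rule has_derivative_transform[OF z, rotated]) (simp add: rect_torsion_swap[OF assms(1,2)])
  have "convex ?R" "interior ?R \<noteq> {}"
    unfolding closed_rect_complex[OF assms(1,2), symmetric]
    by (rule convex_closure[OF convex_open_rect] interior_closure_open_rect[OF assms(1,2)])+
  then have "rect_torsion_grad a b 1 \<i> z = rect_torsion_grad b a \<i> 1 (coords \<i> 1 0 z)"
    by (rule has_derivative_inner_unique_convex[OF _ _ z 1 2])
  then have "(norm (rect_torsion_grad a b 1 \<i> z))^2 = (norm (rect_torsion_grad b a \<i> 1 (coords \<i> 1 0 z)))^2"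
    by simp
  then show ?thesis
    by (simp add: norm_rect_torsion_grad orthonormal_frame_complex coords_swap)
qed

lemma grad_square_vertical:
  assumes "a > 0" "b > 0" "\<bar>Re z\<bar> = a" "\<bar>Im z\<bar> \<le> b"
  shows "grad_square a b z = (side_slope b a (Im z))^2"
  using grad_square_swap[of a b z] grad_square_horizontal[of a "Complex (Im z) (Re z)" b] assms by simp

text \<open>Slopes can thus be compared by comparing values along inward normals. The derivative at
  0 is two-sided because the series lives on the whole strip, beyond the side
  \<open>Im z = b\<close>.\<close>

lemma side_slope_has_derivative:
  assumes "b > 0" "\<bar>x\<bar> \<le> a"
  shows "((\<lambda>t. rect_torsion a b (Complex x (b - t))) has_real_derivative side_slope a b x) (at 0)"
proof -
  let ?S = "{z. \<bar>Re z\<bar> \<le> a}" and ?z = "Complex x b"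
  have "(rect_torsion a b has_derivative (\<lambda>h. rect_torsion_grad a b 1 \<i> ?z \<bullet> h)) (at ?z within ?S)"
    using rect_torsion_has_derivative[OF assms(1), of 1 \<i> 0 ?S a ?z] assms(2) by (auto simp: coords_complex)
  then have "(rect_torsion a b has_derivative (\<lambda>h. rect_torsion_grad a b 1 \<i> ?z \<bullet> h))
      (at (Complex x (b - 0)) within range (\<lambda>t. Complex x (b - t)))"
    using assms(2) by (auto elim!: has_derivative_subset)
  moreover have "((\<lambda>t. of_real x + \<i> * of_real (b - t)) has_derivative (\<lambda>t. - of_real t * \<i>)) (at 0)"
    by (auto intro!: derivative_eq_intros)
  then have "((\<lambda>t. Complex x (b - t)) has_derivative (\<lambda>t. - of_real t * \<i>)) (at 0)"
    by (simp add: Complex_eq)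
  ultimately have "((\<lambda>t. rect_torsion a b (Complex x (b - t))) has_derivative
      (\<lambda>t. rect_torsion_grad a b 1 \<i> ?z \<bullet> (- of_real t * \<i>))) (at 0)"
    using diff_chain_within[of "\<lambda>t. Complex x (b - t)" "\<lambda>t. - of_real t * \<i>" 0 UNIV "rect_torsion a b"]
    unfolding o_def by blast
  moreover have "rect_torsion_grad a b 1 \<i> ?z \<bullet> (- of_real t * \<i>) = side_slope a b x * t" for t
    using torsion_potential'_horizontal(2)[OF assms(1), of ?z a] assms
    by (simp add: rect_torsion_grad_def inner_complex_def)
  ultimately show ?thesis
    by (simp add: has_field_derivative_def)
qed

text \<open>Reflecting the part of the rectangle beyond the line \<open>Re z - Im z = a - b\<close> across this line
  carries the short side into the long one and leaves the reflected part inside the rectangle.\<close>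

lemma rect_torsion_le_reflected:
  assumes "b > 0" "b \<le> a" and z: "Re z \<le> a" "- b \<le> Im z" "a - b \<le> Re z - Im z"
  shows "rect_torsion a b z \<le> rect_torsion a b (Complex (Im z + (a - b)) (Re z - (a - b)))"
proof -
  \<comment> \<open>With this centre \<open>coords \<i> 1 c\<close> is the reflection across the
    line \<open>Re z - Im z = a - b\<close>.\<close>
  define c where "c = Complex (a - b) (- (a - b))"
  \<comment> \<open>The open triangle with vertices (a, b), (a, -b) and (a - 2b, -b). Since
    \<open>b \<le> a\<close>, it and its mirror image lie in the rectangle.\<close>
  define T where "T = {z. Re z < a \<and> - b < Im z \<and> a - b < Re z - Im z}"
  have "a > 0" using assms by simp
  have sw: "coords \<i> 1 c q = Complex (Im q + (a - b)) (Re q - (a - b))" for q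
    by (simp add: coords_swap c_def)
  have cl: "closure T \<subseteq> {z. Re z \<le> a \<and> - b \<le> Im z \<and> a - b \<le> Re z - Im z}" (is "_ \<subseteq> ?C")
    by (rule closure_minimal) (auto simp: T_def intro!: closed_Collect_conj closed_Collect_le continuous_intros)
  have "open T"
    unfolding T_def by (intro open_Collect_conj open_Collect_less continuous_intros)
  have subs: "T \<subseteq> {z. \<bar>Re z\<bar> < a}" "coords \<i> 1 c ` T \<subseteq> {z. \<bar>Re z\<bar> < a}"
    using assms(1,2) by (auto simp: T_def sw)
  have subs': "?C \<subseteq> {z. \<bar>Re z\<bar> \<le> a}" "coords \<i> 1 c ` ?C \<subseteq> {z. \<bar>Re z\<bar> \<le> a}"
    using assms(1,2) by (auto simp: sw)
  \<comment> \<open>Both functions have Laplacian -1, so their difference is harmonic and only its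
    values on the frontier of \<open>T\<close> matter.\<close>
  have "rect_torsion a b (coords 1 \<i> 0 z) - rect_torsion a b (coords \<i> 1 c z) \<le> 0" if "z \<in> closure T" for z
  proof (rule weak_maximum_principle[OF \<open>open T\<close> _ _ has_laplacian_on_diff[OF
        rect_torsion_has_laplacian[OF assms(1) orthonormal_frame_complex(1) _ \<open>open T\<close>]
        rect_torsion_has_laplacian[OF assms(1) orthonormal_frame_complex(2) _ \<open>open T\<close>]] _ _ that])
    have "T \<subseteq> open_rect a b 1 \<i> 0"
      using assms(1,2) by (auto simp: T_def open_rect_def coords_complex simp del: Re_coords Im_coords)
    then show "bounded T"
      using bounded_open_rect[OF orthonormal_frame_complex(1)] bounded_subset by blast
    show "continuous_on (closure T) (\<lambda>z. rect_torsion a b (coords 1 \<i> 0 z) - rect_torsion a b (coords \<i> 1 c z))"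
      using cl subs' by (intro continuous_on_diff continuous_on_rect_torsion assms)
        (auto simp: coords_complex image_subset_iff simp del: Re_coords Im_coords)
    show "coords 1 \<i> 0 ` T \<subseteq> {z. \<bar>Re z\<bar> < a}" "coords \<i> 1 c ` T \<subseteq> {z. \<bar>Re z\<bar> < a}"
      using subs by (auto simp: coords_complex simp del: Re_coords Im_coords)
    fix q assume "q \<in> frontier T"
    then have q: "q \<in> ?C" "q \<notin> T"
      using cl interior_open[OF \<open>open T\<close>] by (auto simp: frontier_def)
    \<comment> \<open>On the mirror line the reflection fixes \<open>q\<close>; on the other two
      edges the first function vanishes and the reflected one is nonnegative.\<close>
    consider "Re q - Im q = a - b" | "Re q = a \<or> Im q = - b"
      using q by (force simp: T_def)
    then show "rect_torsion a b (coords 1 \<i> 0 q) - rect_torsion a b (coords \<i> 1 c q) \<le> 0"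
    proof cases
      case 1
      then have "Complex (Im q + (a - b)) (Re q - (a - b)) = q" by (simp add: complex_eq_iff)
      then show ?thesis by (simp add: sw coords_complex)
    next
      case 2
      have "rect_torsion a b q = 0"
        by (rule rect_torsion_boundary) (use 2 q assms \<open>a > 0\<close> in auto)
      moreover have "rect_torsion a b (coords \<i> 1 c q) \<ge> 0"
        unfolding sw by (rule rect_torsion_nonneg) (use q assms \<open>a > 0\<close> in auto)
      ultimately show ?thesis by (simp add: coords_complex)
    qed
  qed auto
  moreover have "z \<in> closure T"
  proof -
    \<comment> \<open>The target (a - b/2, -3b/4) is a point of \<open>T\<close>, so by convexity
      the points moved from \<open>z\<close> towards it lie in \<open>T\<close>.\<close>
    define f where "f n = z + inverse (real (Suc n)) *\<^sub>R (Complex (a - b / 2) (- b / 4 * 3) - z)" for n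
    have "f n \<in> T" for n
    proof -
      define s where "s = inverse (real (Suc n))"
      have s: "0 < s" "s \<le> 1" by (auto simp: s_def inverse_eq_divide)
      have f: "f n = z + s *\<^sub>R (Complex (a - b / 2) (- b / 4 * 3) - z)"
        by (simp only: f_def s_def)
      have conv: "x < r" if "x = (1 - s) * y + s * w" "y \<le> r" "w < r" for x y w r :: real
      proof -
        have "(1 - s) * y \<le> (1 - s) * r" "s * w < s * r" using that s by (auto intro: mult_left_mono)
        then show ?thesis using that(1) by (simp add: algebra_simps)
      qed
      have "Re (f n) < a"
        by (rule conv[of _ "Re z" "a - b/2"]) (use z assms in \<open>auto simp: f algebra_simps\<close>)
      moreover have "- Im (f n) < b"
        by (rule conv[of _ "- Im z" "b / 4 * 3"]) (use z assms in \<open>auto simp: f algebra_simps\<close>)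
      moreover have "Im (f n) - Re (f n) < b - a"
        by (rule conv[of _ "Im z - Re z" "- b / 4 * 3 - (a - b / 2)"])
          (use z assms in \<open>auto simp: f algebra_simps\<close>)
      ultimately show ?thesis by (auto simp: T_def)
    qed
    moreover have "f \<longlonglongrightarrow> z + 0 *\<^sub>R (Complex (a - b / 2) (- b / 4 * 3) - z)"
      unfolding f_def by (intro tendsto_intros LIMSEQ_inverse_real_of_nat)
    ultimately show ?thesis
      unfolding closure_sequential by (intro exI[of _ f]) simp
  qed
  ultimately show ?thesis
    unfolding sw[symmetric] by (simp add: coords_complex)
qed

text \<open>The reflection takes (a - t, 0), on the normal at the middle of the short side, to (a -
  b, b - t), on a normal of the long side. Hence \<open>g\<close> is nonnegative for small positive
  \<open>t\<close> and zero at 0, and its derivative cannot be negative.\<close>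

lemma side_slope_short_le_long:
  assumes "b > 0" "b \<le> a"
  shows "side_slope b a 0 \<le> side_slope a b (a - b)"
proof (rule ccontr)
  define g where "g t = rect_torsion a b (Complex (a - b) (b - t)) - rect_torsion b a (Complex 0 (a - t))" for t
  have "a > 0" using assms by simp
  assume "\<not> ?thesis"
  then have neg: "side_slope a b (a - b) - side_slope b a 0 < 0" by simp
  have "(g has_real_derivative (side_slope a b (a - b) - side_slope b a 0)) (at 0)"
    unfolding g_def by (intro DERIV_diff side_slope_has_derivative) (use assms in auto)
  from DERIV_neg_dec_right[OF this neg] obtain d where d: "d > 0" "\<And>t. 0 < t \<Longrightarrow> t < d \<Longrightarrow> g t < g 0"
    by auto
  define t where "t = min (d / 2) b"
  have t: "0 < t" "t < d" "t \<le> b" using d(1) assms by (auto simp: t_def)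
  have "g 0 = 0"
    unfolding g_def using rect_torsion_boundary[of a b "Complex (a - b) b"] rect_torsion_boundary[of b a "Complex 0 a"]
      assms by simp
  moreover have "rect_torsion b a (Complex 0 (a - t)) = rect_torsion a b (Complex (a - t) 0)"
    using rect_torsion_swap[of a b "Complex (a - t) 0"] t assms by (simp add: coords_swap)
  moreover have "rect_torsion a b (Complex (a - t) 0) \<le> rect_torsion a b (Complex (a - b) (b - t))"
    using rect_torsion_le_reflected[of b a "Complex (a - t) 0"] t assms by (simp add: algebra_simps)
  ultimately show False
    using d(2)[OF t(1,2)] by (simp add: g_def)
qed

text \<open>With \<open>F = torsion_potential'\<close> the Laplacian of \<open>grad_square\<close> is \<open>4 \<bar>F' - 1/2\<bar>\<^sup>2 + 1\<close>.\<close>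

lemma grad_square_no_interior_max:
  assumes "b > 0" "\<bar>Re z\<bar> < a" "\<delta> > 0"
  shows "\<exists>w. dist w z < \<delta> \<and> grad_square a b z < grad_square a b w"
proof (rule ccontr)
  assume "\<not> ?thesis"
  then have max: "grad_square a b w \<le> grad_square a b z" if "dist w z < \<delta>" for w
    using that by force
  define F where "F = torsion_potential' a b"
  define F1 where "F1 = deriv F"
  define F2 where "F2 = deriv F1"
  \<comment> \<open>Keeps the points \<open>z + of_real t * d\<close> both within distance
    \<open>\<delta>\<close> of \<open>z\<close> and inside the open strip.\<close>
  define \<eta> where "\<eta> = min \<delta> (a - \<bar>Re z\<bar>)"
  have \<eta>: "\<eta> > 0" using assms by (simp add: \<eta>_def)
  let ?S = "{z. \<bar>Re z\<bar> < a}"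
  have hol: "F holomorphic_on ?S" "F1 holomorphic_on ?S"
    unfolding F_def F1_def using torsion_potential'_holomorphic[OF assms(1)] holomorphic_deriv open_strip by blast+
  have dF: "(F has_field_derivative F1 w) (at w)" "(F1 has_field_derivative F2 w) (at w)" if "w \<in> ?S" for w
    unfolding F1_def F2_def using holomorphic_derivI[OF hol(1) open_strip that]
      holomorphic_derivI[OF hol(2)[unfolded F1_def] open_strip that] by auto
  have in_S: "z + of_real t * d \<in> ?S" if "\<bar>t\<bar> < \<eta>" "norm d = 1" for t d
  proof -
    have "\<bar>Re (of_real t * d)\<bar> \<le> \<bar>t\<bar>"
      using abs_Re_le_cmod[of "of_real t * d"] that by (simp add: norm_mult)
    moreover have "\<eta> \<le> a - \<bar>Re z\<bar>" by (simp add: \<eta>_def)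
    ultimately have "\<bar>Re z + Re (of_real t * d)\<bar> < a" using that(1) by linarith
    then show ?thesis by simp
  qed
  have line: "((\<lambda>t. f (z + of_real t * d)) has_vector_derivative f' * d) (at t)"
    if "(f has_field_derivative f') (at (z + of_real t * d))" for f f' d t
  proof -
    have "((\<lambda>t. z + of_real t * d) has_vector_derivative d) (at t)"
      by (auto intro!: derivative_eq_intros simp: has_vector_derivative_def scaleR_conv_of_real)
    from field_vector_diff_chain_at[OF this that] show ?thesis by (simp add: o_def mult.commute)
  qed
  have Re_line: "((\<lambda>t. Re (f (z + of_real t * d))) has_real_derivative Re (f' * d)) (at t)"
    and Im_line: "((\<lambda>t. Im (f (z + of_real t * d))) has_real_derivative Im (f' * d)) (at t)"
    if "(f has_field_derivative f') (at (z + of_real t * d))" for f f' d t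
    unfolding has_real_derivative_iff_has_vector_derivative
    using bounded_linear.has_vector_derivative[OF bounded_linear_Re line[OF that]]
      bounded_linear.has_vector_derivative[OF bounded_linear_Im line[OF that]] by auto
  \<comment> \<open>The left side is the second derivative at 0 of \<open>grad_square\<close> along
    the unit direction \<open>d\<close>.\<close>
  have second: "2 * (Re (F1 z * d))^2 + 2 * Re (F z) * Re (F2 z * d * d)
      + 2 * (Im (F1 z * d) - Im d)^2 + 2 * (Im (F z) - Im z) * Im (F2 z * d * d) \<le> 0" if d: "norm d = 1" for d
  proof (rule second_derivative_nonpos_at_max[OF \<eta>])
    let ?l = "\<lambda>t. z + of_real t * d"
    show "((\<lambda>t. grad_square a b (?l t)) has_real_derivative
        2 * Re (F (?l t)) * Re (F1 (?l t) * d) +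
        2 * (Im (F (?l t)) - Im (?l t)) * (Im (F1 (?l t) * d) - Im d)) (at t)" if "\<bar>t\<bar> < \<eta>" for t
      unfolding grad_square_def F_def[symmetric]
      by (rule DERIV_cong[OF DERIV_add[OF DERIV_power[OF Re_line[OF dF(1)]]
              DERIV_power[OF DERIV_diff[OF Im_line[OF dF(1)] Im_line[OF DERIV_ident]]]]])
        (use in_S[OF that d] in \<open>simp_all add: algebra_simps\<close>)
    have 0: "z + of_real 0 * d \<in> ?S" using assms by simp
    have F1d: "((\<lambda>w. F1 w * d) has_field_derivative F2 z * d) (at (z + of_real 0 * d))"
      using dF(2)[OF 0] by (auto intro!: derivative_eq_intros)
    show "((\<lambda>t. 2 * Re (F (?l t)) * Re (F1 (?l t) * d) +
        2 * (Im (F (?l t)) - Im (?l t)) * (Im (F1 (?l t) * d) - Im d)) has_real_derivative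
        2 * (Re (F1 z * d))^2 + 2 * Re (F z) * Re (F2 z * d * d)
        + 2 * (Im (F1 z * d) - Im d)^2 + 2 * (Im (F z) - Im z) * Im (F2 z * d * d)) (at 0)"
    proof -
      note D = DERIV_mult[OF DERIV_cmult[OF Re_line[OF dF(1)[OF 0]], of 2] Re_line[OF F1d]]
        DERIV_mult[OF DERIV_cmult[OF DERIV_diff[OF Im_line[OF dF(1)[OF 0]] Im_line[OF DERIV_ident]], of 2]
          DERIV_diff[OF Im_line[OF F1d] DERIV_const]]
      show ?thesis
        by (rule DERIV_cong[OF DERIV_add[OF D]]) (simp add: power2_eq_square algebra_simps)
    qed
    show "grad_square a b (?l t) \<le> grad_square a b (?l 0)" if "\<bar>t\<bar> < \<eta>" for t
      using max[of "?l t"] that d by (simp add: dist_norm norm_mult \<eta>_def)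
  qed
  \<comment> \<open>Since \<open>d * d\<close> is 1 for \<open>d = 1\<close> and -1 for
    \<open>d = \<i>\<close>, the terms with \<open>F2\<close> cancel in the sum. The remaining
    squares would force \<open>Re (F1 z)\<close> to be 0 and 1 at once.\<close>
  have "2 * (Re (F1 z))^2 + 2 * (Im (F1 z))^2 + 2 * (Im (F1 z))^2 + 2 * (Re (F1 z) - 1)^2 \<le> 0"
    using second[of 1] second[of \<i>] by simp
  then have "Re (F1 z) = 0" "Re (F1 z) - 1 = 0"
    by (smt (verit) zero_le_power2 power2_eq_iff zero_power2 power2_less_0 power_eq_0_iff)+
  then show False by simp
qed

text \<open>A maximum exists by compactness and lies on the sides, where the values are squares of
  slopes; so only the slopes at the midpoints of the sides compete.\<close>

lemma grad_square_argmax: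
  assumes "b > 0" "b \<le> a" "\<bar>Re z\<bar> \<le> a" "\<bar>Im z\<bar> \<le> b"
  shows "(\<forall>w. \<bar>Re w\<bar> \<le> a \<and> \<bar>Im w\<bar> \<le> b \<longrightarrow> grad_square a b w \<le> grad_square a b z) \<longleftrightarrow>
    (Re z = 0 \<and> \<bar>Im z\<bar> = b) \<or> (a = b \<and> \<bar>Re z\<bar> = a \<and> Im z = 0)"
proof -
  let ?R = "{z. \<bar>Re z\<bar> \<le> a \<and> \<bar>Im z\<bar> \<le> b}"
  let ?G = "grad_square a b"
  let ?Z = "\<lambda>z. (Re z = 0 \<and> \<bar>Im z\<bar> = b) \<or> (a = b \<and> \<bar>Re z\<bar> = a \<and> Im z = 0)"
  define M where "M = side_slope a b 0"
  have "a > 0" using assms by simp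
  have M0: "M \<ge> 0" unfolding M_def using assms by (intro side_slope_nonneg) auto
  have sq: "x^2 \<le> M^2 \<and> (x^2 = M^2 \<longleftrightarrow> x = M)" if "0 \<le> x" "x \<le> M" for x
    using that power_mono[of x M 2] by auto
  have le_mid: "side_slope p q x \<le> side_slope p q 0 \<and> (x \<noteq> 0 \<longrightarrow> side_slope p q x < side_slope p q 0)"
    if "q > 0" "\<bar>x\<bar> \<le> p" for p q x
    using side_slope_less_middle[OF that] by (cases "x = 0") auto
  \<comment> \<open>If \<open>a\<close> differs from \<open>b\<close>, the comparison point
    \<open>a - b\<close> is not the middle of the long side, and strict monotonicity there makes the
    inequality strict.\<close>
  have short: "side_slope b a 0 \<le> M" "a \<noteq> b \<Longrightarrow> side_slope b a 0 < M"
    using side_slope_short_le_long[OF assms(1,2)] le_mid[OF assms(1), of "a - b" a] assms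
    unfolding M_def by auto
  have bd: "?G w \<le> M^2 \<and> (?G w = M^2 \<longleftrightarrow> ?Z w)" if w: "w \<in> ?R" "\<bar>Re w\<bar> = a \<or> \<bar>Im w\<bar> = b" for w
  proof (cases "\<bar>Im w\<bar> = b")
    case True
    have r: "\<bar>Re w\<bar> \<le> a" using w by simp
    have "?G w \<le> M^2 \<and> (?G w = M^2 \<longleftrightarrow> side_slope a b (Re w) = M)"
      unfolding grad_square_horizontal[OF assms(1) r True]
      by (rule sq) (use side_slope_nonneg[OF assms(1) r] le_mid[OF assms(1) r] in \<open>auto simp: M_def\<close>)
    moreover have "side_slope a b (Re w) = M \<longleftrightarrow> Re w = 0"
      using le_mid[OF assms(1) r] by (auto simp: M_def)
    ultimately show ?thesis using True assms(1) by auto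
  next
    case False
    then have r: "\<bar>Re w\<bar> = a" "\<bar>Im w\<bar> \<le> b" using w by auto
    have "?G w \<le> M^2 \<and> (?G w = M^2 \<longleftrightarrow> side_slope b a (Im w) = M)"
      unfolding grad_square_vertical[OF \<open>a > 0\<close> assms(1) r]
      by (rule sq) (use side_slope_nonneg[OF \<open>a > 0\<close> r(2)] le_mid[OF \<open>a > 0\<close> r(2)] short in auto)
    moreover have "side_slope b a (Im w) = M \<longleftrightarrow> a = b \<and> Im w = 0"
      using le_mid[OF \<open>a > 0\<close> r(2)] short by (cases "a = b") (auto simp: M_def)
    ultimately show ?thesis using False r \<open>a > 0\<close> by auto
  qed
  have no_int: "w \<in> ?R \<Longrightarrow> (\<And>y. y \<in> ?R \<Longrightarrow> ?G y \<le> ?G w) \<Longrightarrow> \<bar>Re w\<bar> = a \<or> \<bar>Im w\<bar> = b" for w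
  proof (rule ccontr)
    assume w: "w \<in> ?R" "\<And>y. y \<in> ?R \<Longrightarrow> ?G y \<le> ?G w" "\<not> (\<bar>Re w\<bar> = a \<or> \<bar>Im w\<bar> = b)"
    then have "w \<in> open_rect a b 1 \<i> 0"
      by (auto simp: open_rect_def coords_complex simp del: Re_coords Im_coords)
    then obtain \<delta> where \<delta>: "\<delta> > 0" "ball w \<delta> \<subseteq> open_rect a b 1 \<i> 0"
      using openE[OF open_open_rect] by blast
    have "\<bar>Re w\<bar> < a" using w by auto
    from grad_square_no_interior_max[OF assms(1) this \<delta>(1)]
    obtain y where y: "dist y w < \<delta>" "?G w < ?G y" by auto
    then have "y \<in> closure (open_rect a b 1 \<i> 0)"
      using \<delta>(2) closure_subset by (fastforce simp: dist_commute)
    then show False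
      using w(2)[of y] y(2) unfolding closed_rect_complex[OF \<open>a > 0\<close> assms(1)] by simp
  qed
  have "compact ?R"
    unfolding closed_rect_complex[OF \<open>a > 0\<close> assms(1), symmetric]
    using bounded_open_rect[OF orthonormal_frame_complex(1)] by simp
  moreover have "continuous_on ?R ?G"
    unfolding grad_square_def
    by (intro continuous_intros continuous_on_subset[OF continuous_on_torsion_potential'[OF assms(1), of a]]) auto
  moreover have "z \<in> ?R" using assms by simp
  then have "?R \<noteq> {}" by blast
  ultimately have "\<exists>m\<in>?R. \<forall>y\<in>?R. ?G y \<le> ?G m"
    by (intro continuous_attains_sup)
  then obtain m where m: "m \<in> ?R" "\<And>y. y \<in> ?R \<Longrightarrow> ?G y \<le> ?G m"
    by (elim bexE) (simp only:)
  \<comment> \<open>The maximizer \<open>m\<close> is a boundary point, so the boundary bound at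
    \<open>m\<close> holds on the whole rectangle.\<close>
  have le: "?G w \<le> M^2" if "w \<in> ?R" for w
    using m(2)[OF that] bd[OF m(1) no_int[OF m]] by simp
  have mid: "\<i> * of_real b \<in> ?R" "?G (\<i> * of_real b) = M^2"
    using bd[of "\<i> * of_real b"] assms by auto
  show ?thesis
  proof
    assume "\<forall>w. \<bar>Re w\<bar> \<le> a \<and> \<bar>Im w\<bar> \<le> b \<longrightarrow> ?G w \<le> ?G z"
    then have *: "\<And>w. w \<in> ?R \<Longrightarrow> ?G w \<le> ?G z" by simp
    then have "?G z = M^2"
      using le[OF \<open>z \<in> ?R\<close>] *[OF mid(1)] mid(2) by simp
    with bd[OF \<open>z \<in> ?R\<close> no_int[OF \<open>z \<in> ?R\<close> *]] show "?Z z" by simp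
  next
    assume "?Z z"
    then have "?G z = M^2"
      using bd[OF \<open>z \<in> ?R\<close>] by auto
    then show "\<forall>w. \<bar>Re w\<bar> \<le> a \<and> \<bar>Im w\<bar> \<le> b \<longrightarrow> ?G w \<le> ?G z"
      using le by simp
  qed
qed

section \<open>Rectangles in arbitrary position\<close>

lemma gradient_within_eqI:
  assumes "convex S" "interior S \<noteq> {}" "x \<in> S" "(u has_derivative (\<lambda>h. g \<bullet> h)) (at x within S)"
  shows "gradient_within S u x = g"
  unfolding gradient_within_def has_gradient_within_def
  using assms(4) has_derivative_inner_unique_convex[OF assms(1-3) _ assms(4)] by (rule the_equality)

lemma C1_on_has_gradient:
  assumes "convex S" "interior S \<noteq> {}" "C1_on S u" "x \<in> S"
  shows "(u has_derivative (\<lambda>h. gradient_within S u x \<bullet> h)) (at x within S)"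
proof -
  obtain g where "(u has_derivative (\<lambda>h. g \<bullet> h)) (at x within S)"
    using assms(3,4) unfolding C1_on_def has_gradient_within_def by blast
  with gradient_within_eqI[OF assms(1,2,4)] show ?thesis by simp
qed

text \<open>Convexity makes gradients within \<open>S\<close> unique, so the definite descriptions
  in the definition denote actual derivatives; on the open set these are derivatives in the usual
  sense.\<close>

lemma torsion_function_has_laplacian:
  assumes "convex S" "open S" "torsion_function S u"
  shows "has_laplacian_on u (\<lambda>_. -1) S"
proof (cases "S = {}")
  case False
  then have int: "interior S \<noteq> {}" using assms(2) by (simp add: interior_open)
  define G where "G = gradient_within S u"
  define H where "H e = gradient_within S (\<lambda>x. G x \<bullet> e)" for e
  have C1: "C1_on S u" "\<And>e. e \<in> Basis \<Longrightarrow> C1_on S (\<lambda>x. G x \<bullet> e)"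
    using assms(3) by (auto simp: torsion_function_def C2_on_def G_def)
  have G: "(u has_derivative (\<lambda>h. G x \<bullet> h)) (at x)" if "x \<in> S" for x
    using C1_on_has_gradient[OF assms(1) int C1(1) that] at_within_open[OF that assms(2)] by (simp add: G_def)
  have H: "((\<lambda>x. G x \<bullet> e) has_derivative (\<lambda>h. H e x \<bullet> h)) (at x)" if "x \<in> S" "e \<in> Basis" for x e
    using C1_on_has_gradient[OF assms(1) int C1(2)[OF that(2)] that(1)] at_within_open[OF that(1) assms(2)]
    by (simp add: H_def)
  \<comment> \<open>Differentiability of all components of the gradient gives differentiability of
    the gradient field itself.\<close>
  have "(G has_derivative (\<lambda>h. \<Sum>e\<in>Basis. (H e x \<bullet> h) *\<^sub>R e)) (at x)" if "x \<in> S" for x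
    unfolding has_derivative_componentwise_within[of G] using H[OF that] by simp
  moreover have "-1 = (\<Sum>e\<in>Basis. (\<Sum>e'\<in>Basis. (H e' x \<bullet> e) *\<^sub>R e') \<bullet> e)" if "x \<in> S" for x
  proof -
    have "- laplacian_on S u x = 1" using assms(3) that by (auto simp: torsion_function_def)
    then show ?thesis by (simp add: laplacian_on_def H_def G_def)
  qed
  ultimately show ?thesis
    unfolding has_laplacian_on_def
    by (intro exI[of _ G] exI[of _ "\<lambda>x h. \<Sum>e\<in>Basis. (H e x \<bullet> h) *\<^sub>R e"]) (blast intro: G)
qed (simp add: has_laplacian_on_def)

section \<open>Planar rectangles in normalized coordinates, and their sides\<close>

lemma orthonormal_frameI:
  fixes e1 e2 :: "real^2"
  assumes "norm e1 = 1" "norm e2 = 1" "e1 \<bullet> e2 = 0"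
  shows "orthonormal_frame e1 e2"
proof -
  have ne: "e1 \<noteq> e2" using assms by (auto simp: norm_eq_1)
  have po: "pairwise orthogonal {e1, e2}"
    using assms(3) by (auto simp: pairwise_def orthogonal_def inner_commute)
  then have "independent {e1, e2}"
    by (rule pairwise_orthogonal_independent) (use assms in auto)
  then have span: "UNIV \<subseteq> span {e1, e2}"
    by (intro card_ge_dim_independent) (use ne in auto)
  have "q = (q \<bullet> e1) *\<^sub>R e1 + (q \<bullet> e2) *\<^sub>R e2" for q
  proof -
    have "(\<Sum>i\<in>{e1, e2}. (q \<bullet> i) *\<^sub>R i) = q"
      by (rule orthonormal_basis_expand[OF po]) (use assms(1,2) span in auto)
    then show ?thesis using ne by simp
  qed
  then show ?thesis
    using assms unfolding orthonormal_frame_def norm_eq_1 by blast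
qed

lemma rectangle_eq_open_rect:
  fixes p v w :: "real^2"
  assumes "v \<noteq> 0" "w \<noteq> 0" "v \<bullet> w = 0"
  shows "rectangle p v w
    = open_rect (norm v / 2) (norm w / 2) (v /\<^sub>R norm v) (w /\<^sub>R norm w) (p + (1/2) *\<^sub>R (v + w))"
    (is "_ = open_rect ?a ?b ?e1 ?e2 ?c")
proof -
  have fr: "orthonormal_frame ?e1 ?e2"
    using assms by (intro orthonormal_frameI) auto
  have X: "(p + s *\<^sub>R v + t *\<^sub>R w - ?c) \<bullet> ?e1 = (s - 1/2) * norm v"
    and Y: "(p + s *\<^sub>R v + t *\<^sub>R w - ?c) \<bullet> ?e2 = (t - 1/2) * norm w" for s t
    using assms
    by (simp_all add: algebra_simps inner_diff_left inner_add_left inner_commute[of w v] dot_square_norm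
        power2_eq_square)
  have scale: "\<bar>(s - 1/2) * r\<bar> < r / 2 \<longleftrightarrow> 0 < s \<and> s < 1" if "r > 0" for s r :: real
  proof -
    have "\<bar>(s - 1/2) * r\<bar> < r / 2 \<longleftrightarrow> \<bar>s - 1/2\<bar> * r < 1/2 * r"
      using that by (simp add: abs_mult)
    also have "\<dots> \<longleftrightarrow> \<bar>s - 1/2\<bar> < 1/2"
      using that by (rule mult_less_cancel_right_pos)
    also have "\<dots> \<longleftrightarrow> 0 < s \<and> s < 1" by (auto simp: abs_if)
    finally show ?thesis .
  qed
  have mem: "p + s *\<^sub>R v + t *\<^sub>R w \<in> open_rect ?a ?b ?e1 ?e2 ?c \<longleftrightarrow> 0 < s \<and> s < 1 \<and> 0 < t \<and> t < 1" for s t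
    unfolding open_rect_def mem_Collect_eq Re_coords Im_coords X Y using scale assms by auto
  \<comment> \<open>The parameters (s, t) reach every point of the plane, so membership can be
    decided by \<open>mem\<close> alone.\<close>
  have "\<exists>s t. q = p + s *\<^sub>R v + t *\<^sub>R w" for q
  proof -
    have "q - p = ((q - p) \<bullet> ?e1) *\<^sub>R ?e1 + ((q - p) \<bullet> ?e2) *\<^sub>R ?e2"
      using fr unfolding orthonormal_frame_def by blast
    then have "q = p + ((q - p) \<bullet> ?e1 / norm v) *\<^sub>R v + ((q - p) \<bullet> ?e2 / norm w) *\<^sub>R w"
      by (simp add: field_simps)
    then show ?thesis by blast
  qed
  then show ?thesis
    using mem unfolding rectangle_def by (auto; metis)
qed

lemma rectangle_commute: "rectangle p v w = rectangle p w v"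
proof -
  have "rectangle p v w \<subseteq> rectangle p w v" for v w
    unfolding rectangle_def by (force simp: ac_simps)
  then show ?thesis by blast
qed

lemma longer_sides_commute: "longer_sides p v w = longer_sides p w v"
proof -
  have "sides p v w = sides p w v" by (auto simp: sides_def ac_simps)
  then show ?thesis by (simp add: longer_sides_def)
qed

lemma midpoints_longer_sides:
  assumes "norm w \<le> norm v" "v \<noteq> 0"
  shows "(\<lambda>(a, b). midpoint a b) ` longer_sides p v w =
    {p + (1/2) *\<^sub>R v, p + w + (1/2) *\<^sub>R v} \<union>
    (if norm v = norm w then {p + (1/2) *\<^sub>R w, p + v + (1/2) *\<^sub>R w} else {})"
proof -
  have d: "dist p (p + v) = norm v" "dist (p + w) (p + v + w) = norm v"
    "dist p (p + w) = norm w" "dist (p + v) (p + v + w) = norm w"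
    by (simp_all add: dist_norm algebra_simps)
  have m: "midpoint q (q + x) = q + (1/2) *\<^sub>R x" for q x :: "real^2"
    by (simp add: midpoint_def vec_eq_iff algebra_simps)
  have "longer_sides p v w = {(p, p + v), (p + w, p + v + w)} \<union>
      (if norm v = norm w then {(p, p + w), (p + v, p + v + w)} else {})"
    using assms(1) d unfolding longer_sides_def sides_def by auto
  then show ?thesis
    using m[of p v] m[of "p + w" v] m[of p w] m[of "p + v" w] by (simp add: ac_simps)
qed

text \<open>Here \<open>v\<close> is the longer edge. The solution is identified with the series,
  and the maximizers are transported from the complex plane by the isometry
  \<open>coords\<close>.\<close>

lemma rectangle_max_gradient:
  fixes p v w :: "real^2"
  assumes "v \<noteq> 0" "w \<noteq> 0" "v \<bullet> w = 0" "norm w \<le> norm v"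
    and "\<Omega> = rectangle p v w" and torsion: "torsion_function \<Omega> u"
  shows "C1_on (closure \<Omega>) u \<and>
    {x \<in> closure \<Omega>. \<forall>y \<in> closure \<Omega>.
        norm (gradient_within (closure \<Omega>) u y) \<le> norm (gradient_within (closure \<Omega>) u x)}
      = (\<lambda>(a, b). midpoint a b) ` longer_sides p v w"
proof -
  define a b e1 e2 c where "a = norm v / 2" "b = norm w / 2" "e1 = v /\<^sub>R norm v" "e2 = w /\<^sub>R norm w"
    "c = p + (1/2) *\<^sub>R (v + w)"
  note defs = this
  have ab: "a > 0" "b > 0" "b \<le> a" using assms by (auto simp: defs)
  have fr: "orthonormal_frame e1 e2"
    using assms unfolding defs by (intro orthonormal_frameI) auto
  have \<Omega>: "\<Omega> = open_rect a b e1 e2 c"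
    using rectangle_eq_open_rect[OF assms(1-3)] assms(5) by (simp add: defs)
  let ?z = "coords e1 e2 c" and ?R = "closure \<Omega>"
  have cl: "?R = {q. \<bar>Re (?z q)\<bar> \<le> a \<and> \<bar>Im (?z q)\<bar> \<le> b}"
    unfolding \<Omega> by (rule closure_open_rect[OF ab(1,2)])
  have conv: "convex ?R" "interior ?R \<noteq> {}"
    unfolding \<Omega> by (rule convex_closure[OF convex_open_rect] interior_closure_open_rect[OF ab(1,2)])+
  have u_eq: "u q = rect_torsion a b (?z q)" if "q \<in> ?R" for q
  proof (rule torsion_problem_solution_eq[OF ab(1,2) fr])
    show "has_laplacian_on u (\<lambda>_. - 1) (open_rect a b e1 e2 c)"
      using torsion_function_has_laplacian[OF _ _ torsion] unfolding \<Omega>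
      by (simp add: convex_open_rect open_open_rect)
  qed (use torsion that in \<open>auto simp: torsion_function_def \<Omega>\<close>)
  \<comment> \<open>The identity \<open>u_eq\<close> holds on the closure only, so the derivative
    has to be taken within it.\<close>
  have du: "(u has_derivative (\<lambda>h. rect_torsion_grad a b e1 e2 (?z q) \<bullet> h)) (at q within ?R)" if "q \<in> ?R" for q
    by (rule has_derivative_transform[OF that _ rect_torsion_has_derivative[OF ab(2) _ that]])
      (auto simp: u_eq cl)
  have grad: "gradient_within ?R u q = rect_torsion_grad a b e1 e2 (?z q)" if "q \<in> ?R" for q
    by (rule gradient_within_eqI[OF conv that du[OF that]])
  have "continuous_on ?R (\<lambda>q. torsion_potential' a b (?z q))"
    by (rule continuous_on_compose2[OF continuous_on_torsion_potential'[OF ab(2), of a] continuous_on_coords])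
      (auto simp: cl)
  then have "continuous_on ?R (\<lambda>q. rect_torsion_grad a b e1 e2 (?z q))"
    unfolding rect_torsion_grad_def by (intro continuous_intros continuous_on_coords)
  then have "continuous_on ?R (gradient_within ?R u)"
    by (simp add: grad cong: continuous_on_cong)
  then have C1: "C1_on ?R u"
    using du unfolding C1_on_def has_gradient_within_def by blast
  have norm_le: "norm (gradient_within ?R u y) \<le> norm (gradient_within ?R u x) \<longleftrightarrow>
      grad_square a b (?z y) \<le> grad_square a b (?z x)" if "x \<in> ?R" "y \<in> ?R" for x y
    unfolding grad[OF that(1)] grad[OF that(2)] norm_rect_torsion_grad[OF fr, symmetric] by simp
  have expand: "q - c = ((q - c) \<bullet> e1) *\<^sub>R e1 + ((q - c) \<bullet> e2) *\<^sub>R e2" for q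
    using fr unfolding orthonormal_frame_def by blast
  have z_eq: "?z q = Complex x y \<longleftrightarrow> q = c + x *\<^sub>R e1 + y *\<^sub>R e2" for q x y
  proof
    show "?z q = Complex x y \<Longrightarrow> q = c + x *\<^sub>R e1 + y *\<^sub>R e2"
      using expand[of q] by (simp add: coords_def algebra_simps)
    show "q = c + x *\<^sub>R e1 + y *\<^sub>R e2 \<Longrightarrow> ?z q = Complex x y"
      using fr by (simp add: coords_def orthonormal_frame_def inner_add_left inner_commute[of e2 e1])
  qed
  \<comment> \<open>The coordinates map the closed rectangle onto its complex model, so maximizing
    over either set is the same.\<close>
  have image: "(\<exists>q\<in>?R. ?z q = z)" if "\<bar>Re z\<bar> \<le> a" "\<bar>Im z\<bar> \<le> b" for z
  proof -
    have "?z (c + Re z *\<^sub>R e1 + Im z *\<^sub>R e2) = z" using z_eq[of _ "Re z" "Im z"] by simp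
    moreover from this have "c + Re z *\<^sub>R e1 + Im z *\<^sub>R e2 \<in> ?R"
      unfolding cl mem_Collect_eq using that by metis
    ultimately show ?thesis by blast
  qed
  have max_iff: "(\<forall>y\<in>?R. norm (gradient_within ?R u y) \<le> norm (gradient_within ?R u x)) \<longleftrightarrow>
      (Re (?z x) = 0 \<and> \<bar>Im (?z x)\<bar> = b) \<or> (a = b \<and> \<bar>Re (?z x)\<bar> = a \<and> Im (?z x) = 0)" if x: "x \<in> ?R" for x
  proof -
    have "(\<forall>y\<in>?R. norm (gradient_within ?R u y) \<le> norm (gradient_within ?R u x)) \<longleftrightarrow>
        (\<forall>y\<in>?R. grad_square a b (?z y) \<le> grad_square a b (?z x))"
      using norm_le[OF x] by blast
    also have "\<dots> \<longleftrightarrow> (\<forall>z. \<bar>Re z\<bar> \<le> a \<and> \<bar>Im z\<bar> \<le> b \<longrightarrow> grad_square a b z \<le> grad_square a b (?z x))"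
      using image unfolding cl by blast
    also have "\<dots> \<longleftrightarrow> (Re (?z x) = 0 \<and> \<bar>Im (?z x)\<bar> = b) \<or> (a = b \<and> \<bar>Re (?z x)\<bar> = a \<and> Im (?z x) = 0)"
      using x unfolding cl by (intro grad_square_argmax ab) auto
    finally show ?thesis .
  qed
  have pt: "p + (1/2) *\<^sub>R v = c + 0 *\<^sub>R e1 + (-b) *\<^sub>R e2" "p + w + (1/2) *\<^sub>R v = c + 0 *\<^sub>R e1 + b *\<^sub>R e2"
    "p + (1/2) *\<^sub>R w = c + (-a) *\<^sub>R e1 + 0 *\<^sub>R e2" "p + v + (1/2) *\<^sub>R w = c + a *\<^sub>R e1 + 0 *\<^sub>R e2"
    using assms(1,2) by (simp_all add: defs vec_eq_iff algebra_simps)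
  have vw: "norm v = norm w \<longleftrightarrow> a = b" by (simp add: defs)
  have "x \<in> {p + (1/2) *\<^sub>R v, p + w + (1/2) *\<^sub>R v} \<union>
      (if norm v = norm w then {p + (1/2) *\<^sub>R w, p + v + (1/2) *\<^sub>R w} else {}) \<longleftrightarrow>
      x \<in> ?R \<and> ((Re (?z x) = 0 \<and> \<bar>Im (?z x)\<bar> = b) \<or> (a = b \<and> \<bar>Re (?z x)\<bar> = a \<and> Im (?z x) = 0))" for x
  proof -
    have "x \<in> {p + (1/2) *\<^sub>R v, p + w + (1/2) *\<^sub>R v} \<union>
        (if norm v = norm w then {p + (1/2) *\<^sub>R w, p + v + (1/2) *\<^sub>R w} else {}) \<longleftrightarrow>
        ?z x = Complex 0 (- b) \<or> ?z x = Complex 0 b \<or>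
        (a = b \<and> (?z x = Complex (- a) 0 \<or> ?z x = Complex a 0))"
      unfolding z_eq pt[symmetric] vw by simp
    also have "\<dots> \<longleftrightarrow> x \<in> ?R \<and>
        ((Re (?z x) = 0 \<and> \<bar>Im (?z x)\<bar> = b) \<or> (a = b \<and> \<bar>Re (?z x)\<bar> = a \<and> Im (?z x) = 0))"
      unfolding cl using ab by (auto simp: complex_eq_iff abs_if simp del: Re_coords Im_coords split: if_splits)
    finally show ?thesis .
  qed
  then have "{x \<in> ?R. \<forall>y \<in> ?R. norm (gradient_within ?R u y) \<le> norm (gradient_within ?R u x)}
      = (\<lambda>(a, b). midpoint a b) ` longer_sides p v w"
    unfolding midpoints_longer_sides[OF assms(4,1)] using max_iff by blast
  with C1 show ?thesis by simp
qed

theorem theorem5p1: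
  fixes p v w :: "real^2" and u :: "real^2 \<Rightarrow> real" and \<Omega> :: "(real^2) set"
  assumes "v \<noteq> 0" and "w \<noteq> 0" and "v \<bullet> w = 0"
    and "\<Omega> = rectangle p v w"
    and "torsion_function \<Omega> u"
  shows "C1_on (closure \<Omega>) u \<and>
    {x \<in> closure \<Omega>. \<forall>y \<in> closure \<Omega>.
        norm (gradient_within (closure \<Omega>) u y) \<le> norm (gradient_within (closure \<Omega>) u x)}
      = (\<lambda>(a, b). midpoint a b) ` longer_sides p v w"
proof (cases "norm w \<le> norm v")
  case True
  from rectangle_max_gradient[OF assms(1-3) this assms(4,5)] show ?thesis .
next
  case False
  \<comment> \<open>Rectangle and longer sides are symmetric in \<open>v\<close> and
    \<open>w\<close>, so the edges can exchange roles.\<close>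
  then have "norm v \<le> norm w" by simp
  moreover have "w \<bullet> v = 0" "\<Omega> = rectangle p w v"
    using assms(3,4) by (simp_all add: inner_commute rectangle_commute)
  ultimately show ?thesis
    unfolding longer_sides_commute[of p v w]
    using rectangle_max_gradient[OF assms(2,1) _ _ _ assms(5)] by blast
qed

end
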